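(* Suppose that $\omega(\delta_0)=k(\delta_0)v=O(\delta_0^{1/2})$ is a subwavelength resonant frequency of the scattering problem $(\mathrm{SP}_{\delta_0})$ in the case $\delta_0\to0$, analytic in $\delta_0^{1/2}$, and let $u$ be the corresponding non-trivial solution with $u(x)=e^{-i\frac\omega vx}$ for $x<x_1^-$. Let $\delta=r^2/\delta_0$ (for which $\omega$ is also a resonant frequency of $(\mathrm{SP}_\delta)$), and let $w$ be the corresponding eigenmode of $(\mathrm{SP}_\delta)$, normalized so that $w(x)=\delta_0^{1/2}u(x)$ for $x<x_1^-$. Then, as $\delta_0\to0$ (namely, $\delta\to\infty$), $$w(x)=\begin{cases}c_j+O(\delta^{-1/2}),&x\in(x_{j-1}^+,x_j^-),\ j=1,2,\dots,N+1,\\ c_j+a_j(x-x_j^-)+O(\delta^{-1/2}),&x\in(x_j^-,x_j^+),\ j=1,2,\dots,N.\end{cases}$$ Here $\boldsymbol a=(a_1,a_2,\dots,a_N)^\top$ is the corresponding eigenvector of the generalized capacitance matrix $\mathcal C$, and $c_1=0$, $c_j=c_{j-1}+a_{j-1}\ell_{j-1}$ for $j=2,\dots,N+1$.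
   Context: Setting. There are $N$ resonators $(x_j^-,x_j^+)\subset\mathbb{R}$, $1\le j\le N$, with $x_j^-<x_j^+<x_{j+1}^-$; $D=\bigcup_{j=1}^N(x_j^-,x_j^+)$, $\ell_j=x_j^+-x_j^-$, $s_j=x_{j+1}^--x_j^+$; $x_0^+:=-M$ and $x_{N+1}^-:=M$ for a large enough $M$. $v$ and $v_b$ are the wave speeds outside and inside $D$, $r=v/v_b$ is a fixed positive constant, and $\delta\in\mathbb{C}$ is the density ratio. For $\omega\in\mathbb{C}$ put $k=\omega/v$ and $k_b=\omega/v_b=rk$. $g|_\pm(x)=\lim_{s\to0^+}g(x\pm s)$. The scattering problem $(\mathrm{SP}_\delta)$ is: $u''+k^2u=0$ on $\mathbb{R}\setminus D$; $u''+k_b^2u=0$ on $D$; for all $1\le j\le N$: $u|_+(x_j^\pm)=u|_-(x_j^\pm)$, $u'|_+(x_j^-)=\delta\,u'|_-(x_j^-)$, $u'|_-(x_j^+)=\delta\,u'|_+(x_j^+)$; and $\left(\frac{d}{d|x|}-ik\right)u=0$ for $x\in(-\infty,x_1^-)\cup(x_N^+,+\infty)$. $\omega$ is a resonant frequency if this problem has a non-trivial solution (an eigenmode). For $\delta_0\neq0$ the problems with contrasts $\delta_0$ and $r^2/\delta_0$ have the same resonant frequencies. A resonant frequency is subwavelength (as $\delta_0\to0$) if $\omega(\delta_0)$ depends continuously on $\delta_0\in\mathbb{C}$ for sufficiently small $\delta_0$ and $\omega(\delta_0)\to0$ as $\delta_0\to0$. Put $(t_1,\dots,t_{2N-1})=(r\ell_1,s_1,r\ell_2,s_2,\dots,s_{N-1},r\ell_N)$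 and $\theta_j=\frac1{t_jt_{j+1}}$. The generalized capacitance matrix is the $N\times N$ tridiagonal matrix $$\mathcal C=\begin{pmatrix}\theta_1&-\theta_1\\-\theta_2&\theta_2+\theta_3&-\theta_3\\&-\theta_4&\theta_4+\theta_5&-\theta_5\\&&\ddots&\ddots&\ddots\\&&&-\theta_{2N-4}&\theta_{2N-4}+\theta_{2N-3}&-\theta_{2N-3}\\&&&&-\theta_{2N-2}&\theta_{2N-2}\end{pmatrix},$$ with eigenvalues $0=\lambda_1<\lambda_2<\dots<\lambda_N$. The non-trivial subwavelength resonances as $\delta_0\to0$ are $\omega_1(\delta_0)=O(\delta_0)$, which corresponds to $\lambda_1=0$, and $\omega_i^\pm(\delta_0)=\pm v\sqrt{\lambda_i\delta_0/r}+O(\delta_0)$, which correspond to $\lambda_i$, $2\le i\le N$; "the corresponding eigenvector" refers to this correspondence.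
   Formalization: For a resonance with λ=0 (ω=O(δ₀)), a is the zero vector, not an eigenvector (e.g. ω=0, u=1, w=δ₀^{1/2}); for λ≠0 it is a genuine eigenvector. δ₀ ranges over a set accumulating at 0 that carries a continuous branch of δ₀^{1/2}. *)

theory Defs
  imports
    "HOL-Analysis.Analysis"
    "HOL-Library.Landau_Symbols"
    "Jordan_Normal_Form.Char_Poly"
begin

text \<open>
  The endpoints \<open>x\<^sub>j\<^sup>-\<close>, \<open>x\<^sub>j\<^sup>+\<close> are \<open>xm j\<close>, \<open>xp j\<close> for \<open>1 \<le> j \<le> N\<close>; in addition
  \<open>xp 0 = -M\<close> and \<open>xm (N+1) = M\<close>. That \<open>M\<close> is large enough means that \<open>(-M, M)\<close> contains
  all resonators; this is expressed by the cases \<open>j = 0\<close> and \<open>j = N\<close> of the last conjunct.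
\<close>

definition resonator_chain :: "nat \<Rightarrow> (nat \<Rightarrow> real) \<Rightarrow> (nat \<Rightarrow> real) \<Rightarrow> real \<Rightarrow> bool" where
  "resonator_chain N xm xp M \<longleftrightarrow>
     N \<ge> 1 \<and> xp 0 = - M \<and> xm (N + 1) = M \<and>
     (\<forall>j\<in>{1..N}. xm j < xp j) \<and> (\<forall>j\<in>{0..N}. xp j < xm (j + 1))"

definition res_len :: "(nat \<Rightarrow> real) \<Rightarrow> (nat \<Rightarrow> real) \<Rightarrow> nat \<Rightarrow> real" where
  "res_len xm xp j = xp j - xm j"

definition res_gap :: "(nat \<Rightarrow> real) \<Rightarrow> (nat \<Rightarrow> real) \<Rightarrow> nat \<Rightarrow> real" where
  "res_gap xm xp j = xm (j + 1) - xp j"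

text \<open>
  A solution \<open>u\<close> of \<open>(SP\<^sub>\<delta>)\<close> at frequency \<open>\<omega>\<close>; the witness \<open>u'\<close> is its derivative off the
  interfaces. The Helmholtz equations are required on the open sets on which they make
  classical sense; \<open>u\<close> takes the common one-sided limit as its value at each interface
  point, so that a solution cannot be non-trivial merely by its values there. The radial
  derivative \<open>d/d|x|\<close> in the radiation condition is the derivative in the outward direction, \<open>-d/dx\<close> to the left of the
  chain and \<open>d/dx\<close> to the right of it, wherever the origin lies.
\<close>

definition scattering_solution ::
  "nat \<Rightarrow> (nat \<Rightarrow> real) \<Rightarrow> (nat \<Rightarrow> real) \<Rightarrow> real \<Rightarrow> real \<Rightarrow> complex \<Rightarrow> complex
     \<Rightarrow> (real \<Rightarrow> complex) \<Rightarrow> bool" where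
  "scattering_solution N xm xp v vb \<delta> \<omega> u \<longleftrightarrow>
     (let k = \<omega> / of_real v; kb = \<omega> / of_real vb in
      \<exists>u'.
       (\<forall>x \<in> - (\<Union>j\<in>{1..N}. {xm j..xp j}).
          (u has_vector_derivative u' x) (at x) \<and>
          (u' has_vector_derivative - (k\<^sup>2 * u x)) (at x)) \<and>
       (\<forall>x \<in> (\<Union>j\<in>{1..N}. {xm j<..<xp j}).
          (u has_vector_derivative u' x) (at x) \<and>
          (u' has_vector_derivative - (kb\<^sup>2 * u x)) (at x)) \<and>
       (\<forall>j\<in>{1..N}. \<forall>x\<in>{xm j, xp j}.
          (u \<longlongrightarrow> u x) (at_left x) \<and> (u \<longlongrightarrow> u x) (at_right x)) \<and>
       (\<forall>j\<in>{1..N}. \<exists>d.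
          (u' \<longlongrightarrow> d) (at_left (xm j)) \<and> (u' \<longlongrightarrow> \<delta> * d) (at_right (xm j))) \<and>
       (\<forall>j\<in>{1..N}. \<exists>d.
          (u' \<longlongrightarrow> d) (at_right (xp j)) \<and> (u' \<longlongrightarrow> \<delta> * d) (at_left (xp j))) \<and>
       (\<forall>x < xm 1. - u' x - \<i> * k * u x = 0) \<and>
       (\<forall>x > xp N. u' x - \<i> * k * u x = 0))"

definition eigenmode ::
  "nat \<Rightarrow> (nat \<Rightarrow> real) \<Rightarrow> (nat \<Rightarrow> real) \<Rightarrow> real \<Rightarrow> real \<Rightarrow> complex \<Rightarrow> complex
     \<Rightarrow> (real \<Rightarrow> complex) \<Rightarrow> bool" where
  "eigenmode N xm xp v vb \<delta> \<omega> u \<longleftrightarrow>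
     scattering_solution N xm xp v vb \<delta> \<omega> u \<and> (\<exists>x. u x \<noteq> 0)"

definition resonant_frequency ::
  "nat \<Rightarrow> (nat \<Rightarrow> real) \<Rightarrow> (nat \<Rightarrow> real) \<Rightarrow> real \<Rightarrow> real \<Rightarrow> complex \<Rightarrow> complex \<Rightarrow> bool" where
  "resonant_frequency N xm xp v vb \<delta> \<omega> \<longleftrightarrow> (\<exists>u. eigenmode N xm xp v vb \<delta> \<omega> u)"

text \<open>
  There is no continuous square root on a punctured neighbourhood of \<open>0\<close> in the complex
  plane. A quantity that depends on \<open>\<delta>\<^sub>0\<^sup>1\<^sup>/\<^sup>2\<close> is therefore considered on a set \<open>S\<close> of admissible
  contrasts \<open>\<delta>\<^sub>0\<close> that accumulates at \<open>0\<close> and carries a continuous branch \<open>\<rho>\<close> of the square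
  root, for instance a slit plane with the principal branch, or the positive reals.
\<close>

definition sqrt_branch :: "complex set \<Rightarrow> (complex \<Rightarrow> complex) \<Rightarrow> bool" where
  "sqrt_branch S \<rho> \<longleftrightarrow>
     0 \<notin> S \<and> 0 islimpt S \<and> continuous_on S \<rho> \<and> (\<forall>z\<in>S. (\<rho> z)\<^sup>2 = z)"

definition subwavelength_resonance ::
  "nat \<Rightarrow> (nat \<Rightarrow> real) \<Rightarrow> (nat \<Rightarrow> real) \<Rightarrow> real \<Rightarrow> real \<Rightarrow> complex set
     \<Rightarrow> (complex \<Rightarrow> complex) \<Rightarrow> bool" where
  "subwavelength_resonance N xm xp v vb S \<omega> \<longleftrightarrow>
     (\<exists>\<epsilon>>0. continuous_on (S \<inter> ball 0 \<epsilon>) \<omega> \<and>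
        (\<forall>z \<in> S \<inter> ball 0 \<epsilon>. resonant_frequency N xm xp v vb z (\<omega> z))) \<and>
     (\<omega> \<longlongrightarrow> 0) (at 0 within S)"

definition analytic_in_sqrt ::
  "complex set \<Rightarrow> (complex \<Rightarrow> complex) \<Rightarrow> (complex \<Rightarrow> complex) \<Rightarrow> bool" where
  "analytic_in_sqrt S \<rho> \<omega> \<longleftrightarrow>
     (\<exists>f. f analytic_on {0} \<and> (\<forall>\<^sub>F z in at 0 within S. \<omega> z = f (\<rho> z)))"

text \<open>\<open>(t\<^sub>1, \<dots>, t\<^bsub>2N-1\<^esub>) = (r\<ell>\<^sub>1, s\<^sub>1, r\<ell>\<^sub>2, s\<^sub>2, \<dots>, s\<^bsub>N-1\<^esub>, r\<ell>\<^sub>N)\<close>\<close>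

definition cap_t :: "(nat \<Rightarrow> real) \<Rightarrow> (nat \<Rightarrow> real) \<Rightarrow> real \<Rightarrow> nat \<Rightarrow> real" where
  "cap_t xm xp r j =
     (if odd j then r * res_len xm xp ((j + 1) div 2) else res_gap xm xp (j div 2))"

definition cap_theta :: "(nat \<Rightarrow> real) \<Rightarrow> (nat \<Rightarrow> real) \<Rightarrow> real \<Rightarrow> nat \<Rightarrow> real" where
  "cap_theta xm xp r j = 1 / (cap_t xm xp r j * cap_t xm xp r (j + 1))"

text \<open>Rows and columns are numbered from \<open>1\<close> here; for \<open>N = 1\<close> the matrix is \<open>(0)\<close>.\<close>

definition cap_entry ::
  "nat \<Rightarrow> (nat \<Rightarrow> real) \<Rightarrow> (nat \<Rightarrow> real) \<Rightarrow> real \<Rightarrow> nat \<Rightarrow> nat \<Rightarrow> real" where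
  "cap_entry N xm xp r i j =
     (if i = j then
        (if i = 1 then 0 else cap_theta xm xp r (2 * i - 2)) +
        (if i = N then 0 else cap_theta xm xp r (2 * i - 1))
      else if j = i + 1 then - cap_theta xm xp r (2 * i - 1)
      else if i = j + 1 then - cap_theta xm xp r (2 * i - 2)
      else 0)"

definition cap_matrix ::
  "nat \<Rightarrow> (nat \<Rightarrow> real) \<Rightarrow> (nat \<Rightarrow> real) \<Rightarrow> real \<Rightarrow> real Matrix.mat" where
  "cap_matrix N xm xp r = Matrix.mat N N (\<lambda>(i, j). cap_entry N xm xp r (i + 1) (j + 1))"

text \<open>
  \<open>\<omega>(\<delta>\<^sub>0) = \<plusminus> v (lam \<delta>\<^sub>0 / r)\<^sup>1\<^sup>/\<^sup>2 + O(\<delta>\<^sub>0)\<close> with one sign for the whole branch;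
  for \<open>lam = 0\<close> this reads \<open>\<omega>(\<delta>\<^sub>0) = O(\<delta>\<^sub>0)\<close>.
\<close>

definition corresponds_to ::
  "real \<Rightarrow> real \<Rightarrow> complex set \<Rightarrow> (complex \<Rightarrow> complex) \<Rightarrow> (complex \<Rightarrow> complex) \<Rightarrow> real \<Rightarrow> bool" where
  "corresponds_to v r S \<rho> \<omega> lam \<longleftrightarrow>
     (\<exists>\<sigma>\<in>{1, -1 :: complex}.
        (\<lambda>z. \<omega> z - \<sigma> * of_real v * of_real (sqrt (lam / r)) * \<rho> z) \<in> O[at 0 within S](\<lambda>z. z))"

text \<open>\<open>g(z, x) = O(b(z))\<close> along the filter \<open>F\<close>, uniformly in \<open>x \<in> X\<close>\<close>

definition uniform_bigo ::
  "complex filter \<Rightarrow> real set \<Rightarrow> (complex \<Rightarrow> real \<Rightarrow> complex) \<Rightarrow> (complex \<Rightarrow> real) \<Rightarrow> bool" where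
  "uniform_bigo F X g b \<longleftrightarrow>
     (\<exists>K. \<forall>\<^sub>F z in F. \<forall>x\<in>X. norm (g z x) \<le> K * b z)"

end

theory Submission
  imports Defs "HOL-Complex_Analysis.Cauchy_Integral_Formula"
begin

text \<open>
  Everything is read off by following the mode from left to right. Write \<open>\<rho> = \<delta>\<^sub>0\<^sup>1\<^sup>/\<^sup>2\<close> and
  \<open>\<omega> = f\<^sub>1 \<rho> + O(\<rho>\<^sup>2)\<close>, \<open>\<beta> = f\<^sub>1 / v\<close>, so that \<open>k = \<beta> \<rho> + O(\<rho>\<^sup>2)\<close>. On each of the bounded intervals
  between consecutive interfaces the wave number is \<open>O(\<rho>)\<close>, hence the solution of the Helmholtz
  equation is affine up to \<open>O(\<rho>\<^sup>2)\<close> (\<open>helmholtz_between_asymptotics\<close>). The contrast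
  \<open>\<delta> = r\<^sup>2 / \<rho>\<^sup>2\<close> is large, and the transmission conditions divide the slope by \<open>\<delta>\<close> on leaving a
  resonator and multiply it by \<open>\<delta>\<close> on entering the next one. Across a resonator the mode therefore
  continues with an unchanged slope \<open>a\<^sub>j\<close> and grows from \<open>c\<^sub>j\<close> to \<open>c\<^sub>j + \<ell>\<^sub>j a\<^sub>j\<close>
  (\<open>resonator_step\<close>). In a gap it is constant to leading order, but its slope, of size \<open>\<rho>\<^sup>2\<close>,
  changes by \<open>-k\<^sup>2 s\<^sub>j c\<^sub>j\<^sub>+\<^sub>1\<close>, which is of the same size and is blown up by \<open>\<delta>\<close> to the finite amount
  \<open>-r\<^sup>2 \<beta>\<^sup>2 s\<^sub>j c\<^sub>j\<^sub>+\<^sub>1\<close> (\<open>gap_step\<close>). This gives the recurrence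

    \<open>c\<^sub>j\<^sub>+\<^sub>1 = c\<^sub>j + \<ell>\<^sub>j a\<^sub>j\<close> and \<open>a\<^sub>j\<^sub>+\<^sub>1 = a\<^sub>j - r\<^sup>2 \<beta>\<^sup>2 s\<^sub>j c\<^sub>j\<^sub>+\<^sub>1\<close>,

  and the normalization \<open>w = \<rho> exp (-i k x)\<close> on the left supplies \<open>c\<^sub>1 = 0\<close>, \<open>a\<^sub>1 = -i r\<^sup>2 \<beta>\<close>
  (\<open>mode_expansion\<close>, \<open>incoming_data\<close>).

  If \<open>\<beta> = 0\<close>, all coefficients vanish and \<open>\<omega>\<close> corresponds to the eigenvalue \<open>0\<close>. If \<open>\<beta> \<noteq> 0\<close>, the
  outgoing condition forces \<open>c\<^sub>N\<^sub>+\<^sub>1 = 0\<close>, because the slope \<open>i k w\<close> to the right of the chain has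
  size \<open>\<rho>\<close> unless \<open>w\<close> is small there, whereas it must be \<open>O(\<rho>\<^sup>2)\<close> (\<open>outgoing_limit_zero\<close>).
  With \<open>c\<^sub>1 = c\<^sub>N\<^sub>+\<^sub>1 = 0\<close>, eliminating \<open>c\<close> from the recurrence turns it into the eigenvalue equation of
  the capacitance matrix with eigenvalue \<open>r \<beta>\<^sup>2\<close>; that this number is real and positive is an energy
  identity obtained by summation by parts (\<open>cap_eigenvector_of_limit\<close>). Then
  \<open>f\<^sub>1 = v \<beta>\<close> is one of \<open>\<plusminus> v (lam / r)\<^sup>1\<^sup>/\<^sup>2\<close>, which is the asserted correspondence.
\<close>

section \<open>Low-frequency solutions of the Helmholtz equation on an interval\<close>

text \<open>
  The values \<open>y a\<close>, \<open>y b\<close> are one-sided limits of the solution, while \<open>p\<close> and \<open>q\<close> are the one-sided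
  limits of its derivative. The slopes are separate parameters since the derivative jumps
  at the interfaces.
\<close>

definition helmholtz_between ::
  "complex \<Rightarrow> real \<Rightarrow> real \<Rightarrow> (real \<Rightarrow> complex) \<Rightarrow> complex \<Rightarrow> complex \<Rightarrow> bool" where
  "helmholtz_between \<kappa> a b y p q \<longleftrightarrow>
     (\<exists>y'. (\<forall>x\<in>{a<..<b}. (y has_vector_derivative y' x) (at x) \<and>
                          (y' has_vector_derivative - (\<kappa>\<^sup>2 * y x)) (at x)) \<and>
           (y \<longlongrightarrow> y a) (at_right a) \<and> (y \<longlongrightarrow> y b) (at_left b) \<and>
           (y' \<longlongrightarrow> p) (at_right a) \<and> (y' \<longlongrightarrow> q) (at_left b))"

lemma norm_increment_le:
  fixes f :: "real \<Rightarrow> 'a::real_normed_vector"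
  assumes "a \<le> x" "continuous_on {a..x} f"
    and "\<And>t. a < t \<Longrightarrow> t < x \<Longrightarrow> (f has_vector_derivative f' t) (at t)"
    and "\<And>t. a < t \<Longrightarrow> t < x \<Longrightarrow> norm (f' t) \<le> C"
  shows "norm (f x - f a) \<le> C * (x - a)"
proof (cases "a = x")
  case False
  have "((*) C has_vector_derivative C) (at t)" for t
    by (auto intro!: derivative_eq_intros simp: has_real_derivative_iff_has_vector_derivative [symmetric])
  then have "norm (f x - f a) \<le> C * x - C * a"
    using assms False
    by (intro differentiable_bound_general [of a x f "(*) C" f' "\<lambda>_. C"])
       (auto intro!: continuous_intros)
  then show ?thesis by (simp add: algebra_simps)
qed simp

text \<open>
  At small \<open>\<kappa> (b - a)\<close> an a priori bound replaces the solution formula, and thereby the case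
  distinction at \<open>\<kappa> = 0\<close>. If \<open>m\<close> is the maximum of \<open>|y|\<close>, then \<open>y'' = -\<kappa>\<^sup>2 y\<close> and two integrations put \<open>y\<close>
  within \<open>|\<kappa>|\<^sup>2 (b - a)\<^sup>2 m\<close> of its tangent at \<open>a\<close>. This is at most \<open>m / 2\<close>, so \<open>m\<close> is at most twice
  the bound \<open>B\<close> of the tangent. The last estimate is one order sharper: it integrates \<open>y''\<close> once more with
  \<open>y\<close> replaced by the constant \<open>y a\<close>.
\<close>

lemma helmholtz_between_bounds:
  fixes \<kappa> p q :: complex and y :: "real \<Rightarrow> complex"
  assumes "a < b" and hb: "helmholtz_between \<kappa> a b y p q"
    and small: "(norm \<kappa>)\<^sup>2 * (b - a)\<^sup>2 \<le> 1 / 2"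
  defines "L \<equiv> b - a" and "e \<equiv> (norm \<kappa>)\<^sup>2"
  defines "B \<equiv> norm (y a) + L * norm p"
  shows "\<forall>x\<in>{a..b}. norm (y x - y a - of_real (x - a) * p) \<le> 2 * e * L\<^sup>2 * B" (is ?affine)
    and "norm (q - p) \<le> 2 * e * L * B" (is ?slope)
    and "norm (q - p + \<kappa>\<^sup>2 * of_real L * y a) \<le> e * L * (L * norm p + 2 * e * L\<^sup>2 * B)" (is ?slope2)
proof -
  have L: "L > 0" and e: "e \<ge> 0" "e * L\<^sup>2 \<le> 1 / 2" "norm (\<kappa>\<^sup>2) = e"
    using \<open>a < b\<close> small by (auto simp: L_def e_def norm_power)
  obtain y' where
    dy: "\<And>x. a < x \<Longrightarrow> x < b \<Longrightarrow> (y has_vector_derivative y' x) (at x)" and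
    dy': "\<And>x. a < x \<Longrightarrow> x < b \<Longrightarrow> (y' has_vector_derivative - (\<kappa>\<^sup>2 * y x)) (at x)" and
    lim: "(y \<longlongrightarrow> y a) (at_right a)" "(y \<longlongrightarrow> y b) (at_left b)"
         "(y' \<longlongrightarrow> p) (at_right a)" "(y' \<longlongrightarrow> q) (at_left b)"
    using hb unfolding helmholtz_between_def by (auto simp: Ball_def)
  \<comment> \<open>the derivative, extended continuously to the closed interval\<close>
  define g where "g = (\<lambda>x. if x = a then p else if x = b then q else y' x)"
  have g_ab: "g a = p" "g b = q" using \<open>a < b\<close> by (auto simp: g_def)
  have dy: "(y has_vector_derivative g x) (at x)" if "a < x" "x < b" for x
    using dy [OF that] that by (simp add: g_def)
  have dg: "(g has_vector_derivative - (\<kappa>\<^sup>2 * y x)) (at x)" if "a < x" "x < b" for x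
    by (rule has_vector_derivative_transform_within_open [OF dy' [OF that], of "{a<..<b}"])
       (use that in \<open>auto simp: g_def\<close>)
  have cy: "continuous_on {a..b} y"
    using \<open>a < b\<close> lim
    by (intro continuous_on_IccI) (auto intro!: isContD has_vector_derivative_continuous dy)
  have cg: "continuous_on {a..b} g"
  proof (rule continuous_on_IccI)
    show "(g \<longlongrightarrow> g a) (at_right a)"
      unfolding g_ab
      by (rule Lim_transform_eventually [OF lim(3)])
         (use \<open>a < b\<close> in \<open>auto simp: eventually_at_right g_def intro!: exI [of _ b]\<close>)
    show "(g \<longlongrightarrow> g b) (at_left b)"
      unfolding g_ab
      by (rule Lim_transform_eventually [OF lim(4)])
         (use \<open>a < b\<close> in \<open>auto simp: eventually_at_left g_def intro!: exI [of _ a]\<close>)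
  qed (use \<open>a < b\<close> in \<open>auto intro!: isContD has_vector_derivative_continuous dg\<close>)
  obtain c where c: "c \<in> {a..b}" "\<And>x. x \<in> {a..b} \<Longrightarrow> norm (y x) \<le> norm (y c)"
    using continuous_attains_sup [of "{a..b}" "\<lambda>x. norm (y x)"] continuous_on_norm [OF cy] \<open>a < b\<close>
    by auto
  define m where "m = norm (y c)"
  have m: "norm (y x) \<le> m" if "a \<le> x" "x \<le> b" for x using c that by (simp add: m_def)
  have slope: "norm (g x - p) \<le> e * m * L" if x: "a \<le> x" "x \<le> b" for x
  proof -
    have "norm (g x - g a) \<le> e * m * (x - a)"
      by (rule norm_increment_le [where f' = "\<lambda>x. - (\<kappa>\<^sup>2 * y x)"])
         (use x m e dg in \<open>auto simp: norm_mult intro!: mult_left_mono continuous_on_subset [OF cg]\<close>)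
    also have "\<dots> \<le> e * m * L"
      using x e by (intro mult_left_mono) (auto simp: L_def m_def)
    finally show ?thesis by (simp add: g_ab)
  qed
  have affine: "norm (y x - y a - of_real (x - a) * p) \<le> e * m * L\<^sup>2" if x: "a \<le> x" "x \<le> b" for x
  proof -
    have "norm ((y x - of_real (x - a) * p) - (y a - of_real (a - a) * p)) \<le> e * m * L * (x - a)"
      by (rule norm_increment_le [where f' = "\<lambda>x. g x - p"])
         (use x slope dy in \<open>auto intro!: continuous_intros continuous_on_subset [OF cy] derivative_eq_intros\<close>)
    also have "\<dots> \<le> e * m * L * L"
      using x e L by (intro mult_left_mono) (auto simp: L_def m_def)
    finally show ?thesis by (simp add: power2_eq_square algebra_simps)
  qed
  have "m \<le> 2 * B"
  proof -
    have "m \<le> norm (y c - y a - of_real (c - a) * p) + norm (y a) + norm (of_real (c - a) * p)"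
      unfolding m_def by norm
    also have "norm (of_real (c - a) * p) \<le> L * norm p"
      using c by (auto simp: norm_mult L_def simp flip: of_real_diff intro!: mult_right_mono)
    also have "norm (y c - y a - of_real (c - a) * p) \<le> m / 2"
      using affine [of c] c mult_right_mono [OF e(2), of m]
      by (auto simp: m_def algebra_simps)
    finally show ?thesis by (simp add: B_def)
  qed
  have em: "e * m * L\<^sup>2 \<le> 2 * e * L\<^sup>2 * B" "e * m * L \<le> 2 * e * L * B"
    using mult_left_mono [OF \<open>m \<le> 2 * B\<close>, of "e * L\<^sup>2"] mult_left_mono [OF \<open>m \<le> 2 * B\<close>, of "e * L"] e L
    by (auto simp: algebra_simps)
  show ?affine using affine em by fastforce
  show ?slope using slope [of b] em \<open>a < b\<close> by (auto simp: g_ab)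
  have dev: "norm (y x - y a) \<le> L * norm p + 2 * e * L\<^sup>2 * B" if x: "a \<le> x" "x \<le> b" for x
  proof -
    have "norm (y x - y a) \<le> norm (y x - y a - of_real (x - a) * p) + norm (of_real (x - a) * p)"
      by norm
    also have "norm (of_real (x - a) * p) \<le> L * norm p"
      using x by (auto simp: norm_mult L_def simp flip: of_real_diff intro!: mult_right_mono)
    finally show ?thesis using affine [OF x] em by linarith
  qed
  have "norm ((g b + \<kappa>\<^sup>2 * of_real (b - a) * y a) - (g a + \<kappa>\<^sup>2 * of_real (a - a) * y a))
          \<le> e * (L * norm p + 2 * e * L\<^sup>2 * B) * (b - a)"
  proof (rule norm_increment_le [where f' = "\<lambda>x. - (\<kappa>\<^sup>2 * (y x - y a))"])
    fix t assume t: "a < t" "t < b"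
    show "((\<lambda>x. g x + \<kappa>\<^sup>2 * of_real (x - a) * y a) has_vector_derivative - (\<kappa>\<^sup>2 * (y t - y a))) (at t)"
      using dg [OF t] by (auto intro!: derivative_eq_intros simp: algebra_simps)
    show "norm (- (\<kappa>\<^sup>2 * (y t - y a))) \<le> e * (L * norm p + 2 * e * L\<^sup>2 * B)"
      using dev [of t] t e unfolding norm_minus_cancel norm_mult by (auto intro!: mult_left_mono)
  qed (use \<open>a < b\<close> in \<open>auto intro!: continuous_intros cg\<close>)
  then show ?slope2 by (simp add: g_ab L_def algebra_simps)
qed

lemma bigo_tendsto_zero:
  fixes g \<rho> :: "'a \<Rightarrow> complex"
  assumes "g \<in> O[F](\<rho>)" "(\<rho> \<longlongrightarrow> 0) F"
  shows "(g \<longlongrightarrow> 0) F"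
proof -
  have "\<rho> \<in> o[F](\<lambda>_. 1)" using assms(2) by (auto intro!: smalloI_tendsto)
  from landau_o.big_small_trans [OF assms(1) this] show ?thesis
    by (auto dest: smalloD_tendsto)
qed

text \<open>
  The third part is the one that survives the multiplication by a contrast of size \<open>\<rho>\<^sup>-\<^sup>2\<close>: when the
  slopes themselves have size \<open>\<rho>\<^sup>2\<close>, their change is known up to \<open>O(\<rho>\<^sup>4)\<close>.
\<close>

lemma helmholtz_between_asymptotics:
  fixes \<kappa> p q \<rho> :: "complex \<Rightarrow> complex" and y :: "complex \<Rightarrow> real \<Rightarrow> complex"
  assumes "a < b" and hb: "\<forall>\<^sub>F z in F. helmholtz_between (\<kappa> z) a b (y z) (p z) (q z)"
    and \<kappa>: "\<kappa> \<in> O[F](\<rho>)" and \<rho>: "(\<rho> \<longlongrightarrow> 0) F"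
    and bnd: "(\<lambda>z. y z a) \<in> O[F](\<lambda>_. 1)" "p \<in> O[F](\<lambda>_. 1)"
  shows "uniform_bigo F {a..b} (\<lambda>z x. y z x - y z a - of_real (x - a) * p z) (\<lambda>z. norm (\<rho> z) ^ 2)"
      (is ?affine)
    and "(\<lambda>z. q z - p z) \<in> O[F](\<lambda>z. \<rho> z ^ 2)" (is ?slope)
    and "p \<in> O[F](\<lambda>z. \<rho> z ^ 2) \<Longrightarrow>
      (\<lambda>z. q z - p z + (\<kappa> z)\<^sup>2 * of_real (b - a) * y z a) \<in> O[F](\<lambda>z. \<rho> z ^ 4)" (is "_ \<Longrightarrow> ?slope2")
proof -
  define L where "L = b - a"
  define B where "B = (\<lambda>z. norm (y z a) + L * norm (p z))"
  define e where "e = (\<lambda>z. (norm (\<kappa> z))\<^sup>2)"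
  have L: "L > 0" using \<open>a < b\<close> by (simp add: L_def)
  have "(\<kappa> \<longlongrightarrow> 0) F" by (rule bigo_tendsto_zero [OF \<kappa> \<rho>])
  then have "((\<lambda>z. (norm (\<kappa> z))\<^sup>2 * (b - a)\<^sup>2) \<longlongrightarrow> 0) F"
    by (auto intro!: tendsto_eq_intros)
  then have "\<forall>\<^sub>F z in F. (norm (\<kappa> z))\<^sup>2 * (b - a)\<^sup>2 < 1 / 2"
    by (rule order_tendstoD) simp
  with hb have bounds: "\<forall>\<^sub>F z in F.
      (\<forall>x\<in>{a..b}. norm (y z x - y z a - of_real (x - a) * p z) \<le> 2 * e z * L\<^sup>2 * B z) \<and>
      norm (q z - p z) \<le> 2 * e z * L * B z \<and>
      norm (q z - p z + (\<kappa> z)\<^sup>2 * of_real L * y z a) \<le> e z * L * (L * norm (p z) + 2 * e z * L\<^sup>2 * B z)"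
  proof eventually_elim
    case (elim z)
    from helmholtz_between_bounds [OF \<open>a < b\<close> elim(1)] elim(2)
    show ?case by (auto simp: L_def B_def e_def)
  qed
  have e: "e \<in> O[F](\<lambda>z. norm (\<rho> z) ^ 2)"
    unfolding e_def using \<kappa> by (intro landau_o.big_power) simp
  have "(\<lambda>z. norm (y z a)) \<in> O[F](\<lambda>_. norm (1 :: complex))" "(\<lambda>z. norm (p z)) \<in> O[F](\<lambda>_. norm (1 :: complex))"
    using bnd by (simp_all only: landau_o.big.norm_iff)
  then have B: "B \<in> O[F](\<lambda>_. 1)"
    unfolding B_def using L by (intro sum_in_bigo) auto
  have eB: "(\<lambda>z. 2 * e z * K * B z) \<in> O[F](\<lambda>z. norm (\<rho> z) ^ 2)" for K
    using landau_o.big.mult [OF bigo_const [of "2 * K"] landau_o.big.mult [OF e B]] by (simp add: mult_ac)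
  obtain K where K: "\<forall>\<^sub>F z in F. norm (2 * e z * L\<^sup>2 * B z) \<le> K * norm (norm (\<rho> z) ^ 2)"
    using eB [of "L\<^sup>2"] by (elim landau_o.bigE) auto
  show ?affine
    unfolding uniform_bigo_def
  proof (rule exI [of _ K], use bounds K in eventually_elim)
    case (elim z)
    have "2 * e z * L\<^sup>2 * B z \<le> K * norm (\<rho> z) ^ 2"
      using elim(2) abs_ge_self [of "2 * e z * L\<^sup>2 * B z"] unfolding real_norm_def by simp
    with elim(1) show ?case by force
  qed
  have majorant: "g \<in> O[F](\<lambda>z. \<rho> z ^ n)"
    if "\<forall>\<^sub>F z in F. norm (g z) \<le> h z" "h \<in> O[F](\<lambda>z. norm (\<rho> z) ^ n)"
    for g :: "complex \<Rightarrow> complex" and h n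
  proof -
    have "(\<lambda>z. norm (g z)) \<in> O[F](h)"
      using that(1) by (intro landau_o.bigI [of 1]) (auto elim: eventually_mono)
    then have "(\<lambda>z. norm (g z)) \<in> O[F](\<lambda>z. norm (\<rho> z ^ n))"
      unfolding norm_power using that(2) by (rule landau_o.big_trans)
    then show ?thesis by (simp only: landau_o.big.norm_iff)
  qed
  show ?slope
    by (rule majorant [OF _ eB [of L]]) (use bounds in \<open>auto elim: eventually_mono\<close>)
  assume "p \<in> O[F](\<lambda>z. \<rho> z ^ 2)"
  then have "(\<lambda>z. norm (p z)) \<in> O[F](\<lambda>z. norm (\<rho> z ^ 2))"
    by (simp only: landau_o.big.norm_iff)
  then have "(\<lambda>z. L * norm (p z) + 2 * e z * L\<^sup>2 * B z) \<in> O[F](\<lambda>z. norm (\<rho> z) ^ 2)"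
    using eB L by (intro sum_in_bigo) (auto simp: norm_power)
  from landau_o.big.mult [OF bigo_const [of L] landau_o.big.mult [OF e this]]
  have "(\<lambda>z. e z * L * (L * norm (p z) + 2 * e z * L\<^sup>2 * B z)) \<in> O[F](\<lambda>z. norm (\<rho> z) ^ 4)"
    by (simp add: mult_ac flip: power_add)
  from majorant [OF _ this] show ?slope2
    unfolding L_def [symmetric] by this (use bounds in \<open>auto elim: eventually_mono\<close>)
qed

lemma analytic_first_order:
  fixes f :: "complex \<Rightarrow> complex"
  assumes "f analytic_on {0}"
  shows "(\<lambda>t. f t - f 0 - deriv f 0 * t) \<in> O[nhds 0](\<lambda>t. t\<^sup>2)"
proof -
  obtain d where d: "d > 0" "f holomorphic_on ball 0 d"
    using assms by (auto simp: analytic_on_def)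
  \<comment> \<open>the difference quotient has a removable singularity, so it is differentiable at \<open>0\<close>\<close>
  define g where "g = (\<lambda>t. if t = 0 then deriv f 0 else (f t - f 0) / (t - 0))"
  have "g holomorphic_on ball 0 d"
    unfolding g_def by (rule pole_lemma_open) (use d in auto)
  then have "g field_differentiable at 0"
    using d by (simp add: holomorphic_on_imp_differentiable_at)
  then obtain D where "(g has_field_derivative D) (at 0)"
    by (auto simp: field_differentiable_def)
  then have "(\<lambda>t. (g t - g 0) / t) \<midarrow>0\<rightarrow> D"
    by (simp add: has_field_derivative_iff)
  then have "(\<lambda>t. g t - g 0) \<in> O[at 0](\<lambda>t. t)"
    by (rule bigoI_tendsto) (simp add: eventually_at_filter)
  then have "(\<lambda>t. t * (g t - g 0)) \<in> O[at 0](\<lambda>t. t * t)"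
    by (intro landau_o.big.mult) auto
  also have "(\<lambda>t. t * (g t - g 0)) = (\<lambda>t. f t - f 0 - deriv f 0 * t)"
    by (auto simp: g_def fun_eq_iff field_simps)
  finally obtain C where "\<forall>\<^sub>F t in at 0. norm (f t - f 0 - deriv f 0 * t) \<le> C * norm (t * t)"
    by (elim landau_o.bigE)
  then have "\<forall>\<^sub>F t in nhds 0. norm (f t - f 0 - deriv f 0 * t) \<le> C * norm (t\<^sup>2)"
    by (auto simp: eventually_at_filter power2_eq_square elim!: eventually_mono)
  then show ?thesis by (rule bigoI)
qed

section \<open>Profiles of a scattering solution\<close>

lemma resonator_chain_mono:
  assumes "resonator_chain N xm xp M"
  shows "i \<le> j \<Longrightarrow> j \<le> N \<Longrightarrow> xp i \<le> xp j"
    and "1 \<le> i \<Longrightarrow> i \<le> j \<Longrightarrow> j \<le> N + 1 \<Longrightarrow> xm i \<le> xm j"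
proof -
  have step: "xm j < xp j" if "1 \<le> j" "j \<le> N" for j
    using assms that by (auto simp: resonator_chain_def)
  have gap: "xp j < xm (Suc j)" if "j \<le> N" for j
    using assms that by (auto simp: resonator_chain_def)
  show "xp i \<le> xp j" if "i \<le> j" "j \<le> N"
    using that
  proof (induction j rule: dec_induct)
    case (step n)
    with gap [of n] \<open>\<And>j. 1 \<le> j \<Longrightarrow> j \<le> N \<Longrightarrow> xm j < xp j\<close> [of "Suc n"] show ?case by simp
  qed simp
  show "xm i \<le> xm j" if "1 \<le> i" "i \<le> j" "j \<le> N + 1"
    using that(2,3)
  proof (induction j rule: dec_induct)
    case (step n)
    with gap [of n] \<open>\<And>j. 1 \<le> j \<Longrightarrow> j \<le> N \<Longrightarrow> xm j < xp j\<close> [of n] that(1) show ?case by simp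
  qed simp
qed

text \<open>
  The jump conditions are built into the slopes: \<open>dm j\<close> and \<open>dp j\<close> are the derivatives on the
  outer sides of \<open>xm j\<close> and \<open>xp j\<close>, and the derivatives on the inner sides are \<open>\<delta>\<close> times as
  large. The last gap ends at the artificial point \<open>xm (N + 1) = M\<close>, an ordinary point of the exterior,
  where \<open>dm (N + 1)\<close> is simply the derivative. The radiation condition, which
  holds up to the outermost interfaces by continuity, closes the system at both ends.
\<close>

lemma scattering_solution_profiles:
  assumes chain: "resonator_chain N xm xp M"
    and sol: "scattering_solution N xm xp v vb \<delta> \<omega> u"
  shows "\<exists>dm dp. (\<forall>j\<in>{1..N}.
             helmholtz_between (\<omega> / of_real vb) (xm j) (xp j) u (\<delta> * dm j) (\<delta> * dp j) \<and>
             helmholtz_between (\<omega> / of_real v) (xp j) (xm (j + 1)) u (dp j) (dm (j + 1))) \<and>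
           dm 1 = - \<i> * (\<omega> / of_real v) * u (xm 1) \<and>
           dp N = \<i> * (\<omega> / of_real v) * u (xp N) \<and>
           (u \<longlongrightarrow> u (xm 1)) (at_left (xm 1))"
proof -
  define k kb where "k = \<omega> / of_real v" and "kb = \<omega> / of_real vb"
  have N: "N \<ge> 1" using chain by (simp add: resonator_chain_def)
  obtain u' where
    outer0: "\<forall>x \<in> - (\<Union>j\<in>{1..N}. {xm j..xp j}).
        (u has_vector_derivative u' x) (at x) \<and> (u' has_vector_derivative - (k\<^sup>2 * u x)) (at x)" and
    inner0: "\<forall>x \<in> (\<Union>j\<in>{1..N}. {xm j<..<xp j}).
        (u has_vector_derivative u' x) (at x) \<and> (u' has_vector_derivative - (kb\<^sup>2 * u x)) (at x)" and
    cont0: "\<forall>j\<in>{1..N}. \<forall>x\<in>{xm j, xp j}. (u \<longlongrightarrow> u x) (at_left x) \<and> (u \<longlongrightarrow> u x) (at_right x)" and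
    jump_m: "\<forall>j\<in>{1..N}. \<exists>d. (u' \<longlongrightarrow> d) (at_left (xm j)) \<and> (u' \<longlongrightarrow> \<delta> * d) (at_right (xm j))" and
    jump_p: "\<forall>j\<in>{1..N}. \<exists>d. (u' \<longlongrightarrow> d) (at_right (xp j)) \<and> (u' \<longlongrightarrow> \<delta> * d) (at_left (xp j))" and
    rad_l: "\<forall>x < xm 1. - u' x - \<i> * k * u x = 0" and
    rad_r: "\<forall>x > xp N. u' x - \<i> * k * u x = 0"
    using sol unfolding scattering_solution_def Let_def k_def [symmetric] kb_def [symmetric] by blast
  have outer: "(u has_vector_derivative u' x) (at x) \<and> (u' has_vector_derivative - (k\<^sup>2 * u x)) (at x)"
    if "x \<notin> (\<Union>j\<in>{1..N}. {xm j..xp j})" for x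
    using outer0 that by blast
  have inner: "(u has_vector_derivative u' x) (at x) \<and> (u' has_vector_derivative - (kb\<^sup>2 * u x)) (at x)"
    if "j \<in> {1..N}" "x \<in> {xm j<..<xp j}" for x j
    using inner0 that by blast
  have cont: "(u \<longlongrightarrow> u x) (at_left x) \<and> (u \<longlongrightarrow> u x) (at_right x)"
    if "j \<in> {1..N}" "x \<in> {xm j, xp j}" for j x
    using cont0 that by blast
  obtain dm0 where dm0: "\<And>j. j \<in> {1..N} \<Longrightarrow>
      (u' \<longlongrightarrow> dm0 j) (at_left (xm j)) \<and> (u' \<longlongrightarrow> \<delta> * dm0 j) (at_right (xm j))"
    using bchoice [OF jump_m] by blast
  obtain dp where dp: "\<And>j. j \<in> {1..N} \<Longrightarrow>
      (u' \<longlongrightarrow> dp j) (at_right (xp j)) \<and> (u' \<longlongrightarrow> \<delta> * dp j) (at_left (xp j))"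
    using bchoice [OF jump_p] by blast
  define dm where "dm = (\<lambda>j. if j = N + 1 then u' (xm (N + 1)) else dm0 j)"
  have off: "x \<notin> (\<Union>i\<in>{1..N}. {xm i..xp i})"
    if j: "j \<in> {1..N}" and x: "xp j < x" "x < xm (j + 1) \<or> j = N" for x j
  proof
    assume "x \<in> (\<Union>i\<in>{1..N}. {xm i..xp i})"
    then obtain i where i: "i \<in> {1..N}" "xm i \<le> x" "x \<le> xp i" by auto
    show False
    proof (cases "i \<le> j")
      case True
      with resonator_chain_mono(1) [OF chain, of i j] i j x show False by auto
    next
      case False
      with resonator_chain_mono(2) [OF chain, of "j + 1" i] i j x show False by auto
    qed
  qed
  have gap_end: "(u \<longlongrightarrow> u (xm (j + 1))) (at_left (xm (j + 1)))
               \<and> (u' \<longlongrightarrow> dm (j + 1)) (at_left (xm (j + 1)))" if j: "j \<in> {1..N}" for j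
  proof (cases "j = N")
    case True
    have "xp N < xm (N + 1)" using chain by (auto simp: resonator_chain_def)
    with off [OF j, of "xm (N + 1)"] True outer [of "xm (N + 1)"]
    have "isCont u (xm (N + 1))" "isCont u' (xm (N + 1))"
      by (auto intro: has_vector_derivative_continuous)
    then show ?thesis
      using True by (auto simp: dm_def isCont_def intro: tendsto_mono at_le)
  next
    case False
    with j cont [of "j + 1" "xm (j + 1)"] dm0 [of "j + 1"] show ?thesis by (auto simp: dm_def)
  qed
  have "helmholtz_between kb (xm j) (xp j) u (\<delta> * dm j) (\<delta> * dp j)" if j: "j \<in> {1..N}" for j
    unfolding helmholtz_between_def
    by (rule exI [of _ u'])
       (use j inner [OF j] cont [OF j] dm0 [OF j] dp [OF j] in \<open>auto simp: dm_def\<close>)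
  moreover have "helmholtz_between k (xp j) (xm (j + 1)) u (dp j) (dm (j + 1))" if j: "j \<in> {1..N}" for j
    unfolding helmholtz_between_def
    by (rule exI [of _ u'])
       (use outer [OF off [OF j]] cont [OF j] gap_end [OF j] dp [OF j] in auto)
  moreover have "dm 1 = - \<i> * k * u (xm 1)"
  proof (rule tendsto_unique)
    have "((\<lambda>x. - \<i> * k * u x) \<longlongrightarrow> - \<i> * k * u (xm 1)) (at_left (xm 1))"
      using cont [of 1] N by (intro tendsto_intros) auto
    moreover have "- \<i> * k * u x = u' x" if "x < xm 1" for x
    proof -
      have "- \<i> * k * u x = u' x + (- u' x - \<i> * k * u x)" by simp
      with rad_l that show ?thesis by simp
    qed
    then have "\<forall>\<^sub>F x in at_left (xm 1). - \<i> * k * u x = u' x"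
      by (intro eventually_at_leftI [of "xm 1 - 1"]) auto
    ultimately show "(u' \<longlongrightarrow> - \<i> * k * u (xm 1)) (at_left (xm 1))"
      by (rule Lim_transform_eventually)
    show "(u' \<longlongrightarrow> dm 1) (at_left (xm 1))"
      using dm0 [of 1] N by (auto simp: dm_def)
  qed simp
  moreover have "dp N = \<i> * k * u (xp N)"
  proof (rule tendsto_unique)
    have "((\<lambda>x. \<i> * k * u x) \<longlongrightarrow> \<i> * k * u (xp N)) (at_right (xp N))"
      using cont [of N] N by (intro tendsto_intros) auto
    moreover have "\<forall>\<^sub>F x in at_right (xp N). \<i> * k * u x = u' x"
      using rad_r by (intro eventually_at_rightI [of _ "xp N + 1"]) auto
    ultimately show "(u' \<longlongrightarrow> \<i> * k * u (xp N)) (at_right (xp N))"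
      by (rule Lim_transform_eventually)
    show "(u' \<longlongrightarrow> dp N) (at_right (xp N))"
      using dp [of N] N by auto
  qed simp
  ultimately show ?thesis
    unfolding k_def kb_def using cont [of 1 "xm 1"] N by (intro exI [of _ dm] exI [of _ dp]) auto
qed

section \<open>The limiting recurrence and the capacitance matrix\<close>

lemma limit_coefficients_exist:
  fixes \<mu> \<alpha> :: complex and len s :: "nat \<Rightarrow> real"
  shows "\<exists>a c. a 1 = \<alpha> \<and> c 1 = 0 \<and> (\<forall>j\<ge>1. c (j + 1) = c j + a j * of_real (len j) \<and>
                                        a (j + 1) = a j - \<mu> * of_real (s j) * c (j + 1))"
proof -
  define f where "f = rec_nat (\<alpha>, 0) (\<lambda>n (a, c). let c' = c + a * of_real (len (Suc n)) in
                                           (a - \<mu> * of_real (s (Suc n)) * c', c'))"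
  show ?thesis
  proof (intro exI conjI allI impI)
    fix j :: nat assume "j \<ge> 1"
    then obtain n where "j = Suc n" by (cases j) auto
    then show "snd (f (j + 1 - 1)) = snd (f (j - 1)) + fst (f (j - 1)) * of_real (len j)"
      and "fst (f (j + 1 - 1)) = fst (f (j - 1)) - \<mu> * of_real (s j) * snd (f (j + 1 - 1))"
      by (auto simp: f_def Let_def split: prod.splits)
  qed (simp_all add: f_def)
qed

lemma cap_row_sum:
  fixes a :: "nat \<Rightarrow> complex"
  assumes i: "i \<in> {1..N}"
  shows "(\<Sum>j=1..N. of_real (cap_entry N xm xp r i j) * a j) =
           (if i = 1 then 0 else of_real (cap_theta xm xp r (2 * i - 2)) * (a i - a (i - 1))) +
           (if i = N then 0 else of_real (cap_theta xm xp r (2 * i - 1)) * (a i - a (i + 1)))"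
proof -
  define \<theta>l \<theta>u :: complex where
    "\<theta>l = of_real (cap_theta xm xp r (2 * i - 2))" and "\<theta>u = of_real (cap_theta xm xp r (2 * i - 1))"
  have "(\<Sum>j=1..N. of_real (cap_entry N xm xp r i j) * a j) =
        (\<Sum>j=1..N. (if j = i then ((if i = 1 then 0 else \<theta>l) + (if i = N then 0 else \<theta>u)) * a j else 0) +
                   (if j = i + 1 then - \<theta>u * a j else 0) + (if j = i - 1 then - \<theta>l * a j else 0))"
    using i by (intro sum.cong) (auto simp: cap_entry_def \<theta>l_def \<theta>u_def)
  also have "\<dots> = ((if i = 1 then 0 else \<theta>l) + (if i = N then 0 else \<theta>u)) * a i
                  + (if i = N then 0 else - \<theta>u * a (i + 1)) + (if i = 1 then 0 else - \<theta>l * a (i - 1))"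
    using i by (auto simp: sum.distrib sum.delta)
  also have "\<dots> = (if i = 1 then 0 else \<theta>l * (a i - a (i - 1))) + (if i = N then 0 else \<theta>u * (a i - a (i + 1)))"
    by (auto simp: algebra_simps)
  finally show ?thesis by (simp add: \<theta>l_def \<theta>u_def)
qed

lemma cap_theta_even:
  assumes "i \<ge> 2"
  shows "cap_theta xm xp r (2 * i - 2) = 1 / (r * res_len xm xp i * res_gap xm xp (i - 1))"
proof -
  from assms obtain n where "i = n + 2" by (metis le_add_diff_inverse2)
  then show ?thesis by (simp add: cap_theta_def cap_t_def mult_ac)
qed

lemma cap_theta_odd:
  assumes "i \<ge> 1"
  shows "cap_theta xm xp r (2 * i - 1) = 1 / (r * res_len xm xp i * res_gap xm xp i)"
proof -
  from assms obtain n where "i = n + 1" by (metis le_add_diff_inverse2)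
  then show ?thesis by (simp add: cap_theta_def cap_t_def mult_ac)
qed

lemma cap_eigenvector_iff:
  fixes a :: "nat \<Rightarrow> complex"
  shows "eigenvector (map_mat complex_of_real (cap_matrix N xm xp r)) (Matrix.vec N (\<lambda>i. a (i + 1))) lam \<longleftrightarrow>
           (\<exists>i\<in>{1..N}. a i \<noteq> 0) \<and>
           (\<forall>i\<in>{1..N}. (\<Sum>j=1..N. of_real (cap_entry N xm xp r i j) * a j) = lam * a i)"
proof -
  have range: "{1..N} = Suc ` {0..<N}"
    by (simp add: image_Suc_atLeastLessThan atLeastLessThanSuc_atLeastAtMost)
  have all: "(\<forall>i\<in>{1..N}. P i) \<longleftrightarrow> (\<forall>i<N. P (Suc i))"
    and ex: "(\<exists>i\<in>{1..N}. P i) \<longleftrightarrow> (\<exists>i<N. P (Suc i))"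
    and sum: "sum g {1..N} = (\<Sum>i=0..<N. g (Suc i))" for P and g :: "nat \<Rightarrow> complex"
    unfolding range by (auto simp: sum.reindex simp del: image_Suc_atLeastLessThan)
  show ?thesis
    unfolding eigenvector_def all ex sum
    by (auto simp: vec_eq_iff cap_matrix_def scalar_prod_def)
qed

text \<open>
  A complex eigenvector need not be real, but a real root of the characteristic polynomial over the
  complex numbers is a root over the reals.
\<close>

lemma cap_eigenvalue_of_complex:
  assumes "eigenvalue (map_mat complex_of_real (cap_matrix N xm xp r)) (of_real lam)"
  shows "eigenvalue (cap_matrix N xm xp r) lam"
proof -
  have C: "cap_matrix N xm xp r \<in> carrier_mat N N" by (simp add: cap_matrix_def)
  from assms have "poly (map_poly complex_of_real (char_poly (cap_matrix N xm xp r))) (of_real lam) = 0"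
    using C by (simp add: eigenvalue_root_char_poly [of _ N] of_real_hom.char_poly_hom [OF C])
  then show ?thesis using C by (simp add: eigenvalue_root_char_poly [of _ N])
qed

text \<open>
  The rows of the capacitance matrix sum to zero, so the constant vector is in its kernel.
\<close>

lemma cap_zero_eigenvalue:
  assumes "N \<ge> 1"
  shows "eigenvalue (cap_matrix N xm xp r) 0"
proof (rule cap_eigenvalue_of_complex)
  have "eigenvector (map_mat complex_of_real (cap_matrix N xm xp r)) (Matrix.vec N (\<lambda>_. 1)) 0"
    using assms cap_eigenvector_iff [of N xm xp r "\<lambda>_. 1" 0] cap_row_sum [of _ N xm xp r "\<lambda>_. 1"]
    by auto
  then show "eigenvalue (map_mat complex_of_real (cap_matrix N xm xp r)) (of_real 0)"
    unfolding eigenvalue_def by auto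
qed

text \<open>
  Summation by parts: \<open>\<ell>\<^sub>j a\<^sub>j\<close> is the increment of \<open>c\<close>, and the increment of \<open>cnj a\<close> is a multiple of \<open>cnj c\<close>.
\<close>

lemma limit_energy_identity:
  fixes a c :: "nat \<Rightarrow> complex" and len s :: "nat \<Rightarrow> real"
  assumes "c 1 = 0"
    and c: "\<And>j. j \<ge> 1 \<Longrightarrow> c (j + 1) = c j + a j * of_real (len j)"
    and a: "\<And>j. j \<ge> 1 \<Longrightarrow> a (j + 1) = a j - \<mu> * of_real (s j) * c (j + 1)"
  shows "of_real (\<Sum>j=1..n. len j * (norm (a j))\<^sup>2) =
           cnj \<mu> * of_real (\<Sum>j=1..n. s j * (norm (c (j + 1)))\<^sup>2) + cnj (a (n + 1)) * c (n + 1)"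
proof (induction n)
  case (Suc n)
  have "cnj (a (Suc n + 1)) = cnj (a (Suc n) - \<mu> * of_real (s (Suc n)) * c (Suc n + 1))"
    by (simp only: a [of "Suc n"])
  then have a': "cnj (a (Suc n + 1)) = cnj (a (Suc n)) - cnj \<mu> * of_real (s (Suc n)) * cnj (c (Suc n + 1))"
    by simp
  have c': "c (Suc n + 1) - c (n + 1) = complex_of_real (len (Suc n)) * a (Suc n)"
    using c [of "Suc n"] by simp
  have "cnj \<mu> * (of_real (s (Suc n)) * (c (Suc n + 1) * cnj (c (Suc n + 1))))
          + cnj (a (Suc n + 1)) * c (Suc n + 1) - cnj (a (n + 1)) * c (n + 1)
        = cnj (a (n + 1)) * (c (Suc n + 1) - c (n + 1))"
    unfolding a' by (simp add: algebra_simps)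
  also have "\<dots> = complex_of_real (len (Suc n)) * (a (Suc n) * cnj (a (Suc n)))"
    unfolding c' by simp
  finally have "complex_of_real (len (Suc n)) * (a (Suc n) * cnj (a (Suc n))) =
          cnj \<mu> * (of_real (s (Suc n)) * (c (Suc n + 1) * cnj (c (Suc n + 1))))
          + cnj (a (Suc n + 1)) * c (Suc n + 1) - cnj (a (n + 1)) * c (n + 1)" ..
  then have "complex_of_real (len (Suc n) * (norm (a (Suc n)))\<^sup>2) =
          cnj \<mu> * of_real (s (Suc n) * (norm (c (Suc n + 1)))\<^sup>2) + cnj (a (Suc n + 1)) * c (Suc n + 1)
          - cnj (a (n + 1)) * c (n + 1)"
    by (simp only: of_real_mult complex_norm_square)
  with Suc show ?case by (simp add: algebra_simps)
qed (simp add: \<open>c 1 = 0\<close>[unfolded One_nat_def])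

text \<open>
  With \<open>c\<close> vanishing at both ends, the boundary term of the energy identity drops out and the
  identity equates a positive number to \<open>r cnj lam\<close> times a nonnegative one; hence \<open>lam\<close> is real and
  positive. The two neighbour terms of row \<open>i\<close> are differences of consecutive \<open>a\<close>; by the recurrence they
  equal \<open>- lam c\<^sub>i / \<ell>\<^sub>i\<close> and \<open>lam c\<^sub>i\<^sub>+\<^sub>1 / \<ell>\<^sub>i\<close>, and their sum is \<open>lam a\<^sub>i\<close>. As \<open>c\<close> vanishes at both ends, this stays true for the
  missing neighbours in the first and the last row.
\<close>

lemma cap_eigenvector_of_limit:
  fixes a c :: "nat \<Rightarrow> complex" and xm xp :: "nat \<Rightarrow> real"
  defines "len \<equiv> res_len xm xp" and "s \<equiv> res_gap xm xp"
  assumes chain: "resonator_chain N xm xp M" and "r > 0"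
    and c1: "c 1 = 0" and cN: "c (N + 1) = 0" and a1: "a 1 \<noteq> 0"
    and c: "\<And>j. j \<ge> 1 \<Longrightarrow> c (j + 1) = c j + a j * of_real (len j)"
    and a: "\<And>j. j \<ge> 1 \<Longrightarrow> a (j + 1) = a j - of_real r * lam * of_real (s j) * c (j + 1)"
  shows "Im lam = 0" and "Re lam > 0"
    and "eigenvector (map_mat complex_of_real (cap_matrix N xm xp r)) (Matrix.vec N (\<lambda>i. a (i + 1))) lam"
proof -
  have N: "N \<ge> 1" and len: "\<And>j. j \<in> {1..N} \<Longrightarrow> len j > 0" and s: "\<And>j. j \<in> {1..N} \<Longrightarrow> s j > 0"
    using chain by (auto simp: resonator_chain_def len_def s_def res_len_def res_gap_def)
  define P Q where "P = (\<Sum>j=1..N. len j * (norm (a j))\<^sup>2)" and "Q = (\<Sum>j=1..N. s j * (norm (c (j + 1)))\<^sup>2)"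
  have PQ: "of_real P = cnj (of_real r * lam) * of_real Q"
    using limit_energy_identity [of c a len "of_real r * lam" s N] c1 c a cN by (simp add: P_def Q_def)
  have "P > 0"
    unfolding P_def
  proof (rule sum_pos2 [of _ 1])
    show "0 < len 1 * (norm (a 1))\<^sup>2" using N len a1 by simp
    show "0 \<le> len i * (norm (a i))\<^sup>2" if "i \<in> {1..N}" for i using len [OF that] by simp
  qed (use N in auto)
  moreover have "Q \<ge> 0"
    unfolding Q_def by (intro sum_nonneg mult_nonneg_nonneg less_imp_le [OF s]) auto
  ultimately have "Q > 0" using PQ by (cases "Q = 0") auto
  have "Im (of_real P) = Im (cnj (of_real r * lam) * of_real Q)" "Re (of_real P) = Re (cnj (of_real r * lam) * of_real Q)"
    by (simp_all only: PQ)
  then have "r * Q * Im lam = 0" "P = r * Q * Re lam" by (simp_all add: mult_ac)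
  moreover have "r * Q > 0" using \<open>r > 0\<close> \<open>Q > 0\<close> by simp
  ultimately show "Im lam = 0" "Re lam > 0"
    using \<open>P > 0\<close> zero_less_mult_pos [of "r * Q" "Re lam"] by auto
  have row: "(\<Sum>j=1..N. of_real (cap_entry N xm xp r i j) * a j) = lam * a i" if i: "i \<in> {1..N}" for i
  proof -
    have left: "(if i = 1 then 0 else of_real (cap_theta xm xp r (2 * i - 2)) * (a i - a (i - 1)))
                 = - lam * c i / of_real (len i)"
    proof (cases "i = 1")
      case False
      then have "i - 1 \<in> {1..N}" using i by auto
      then have "s (i - 1) > 0" by (rule s)
      moreover have "a i - a (i - 1) = - (of_real r * lam * of_real (s (i - 1)) * c i)"
        using a [of "i - 1"] False i by auto
      moreover have "cap_theta xm xp r (2 * i - 2) = 1 / (r * len i * s (i - 1))"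
        unfolding len_def s_def by (rule cap_theta_even) (use False i in auto)
      ultimately show ?thesis
        using False len [OF i] \<open>r > 0\<close> by simp
    qed (use c1 in simp)
    have right: "(if i = N then 0 else of_real (cap_theta xm xp r (2 * i - 1)) * (a i - a (i + 1)))
                 = lam * c (i + 1) / of_real (len i)"
    proof (cases "i = N")
      case False
      have "a i - a (i + 1) = of_real r * lam * of_real (s i) * c (i + 1)"
        using a [of i] i by simp
      moreover have "cap_theta xm xp r (2 * i - 1) = 1 / (r * len i * s i)"
        unfolding len_def s_def by (rule cap_theta_odd) (use i in simp)
      ultimately show ?thesis
        using False len [OF i] s [OF i] \<open>r > 0\<close> by simp
    qed (use cN in simp)
    show ?thesis
      unfolding cap_row_sum [OF i] left right using c [of i] i len [OF i] by (simp add: field_simps)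
  qed
  then show "eigenvector (map_mat complex_of_real (cap_matrix N xm xp r)) (Matrix.vec N (\<lambda>i. a (i + 1))) lam"
    unfolding cap_eigenvector_iff using a1 N by (auto intro!: bexI [of _ 1])
qed

section \<open>Order calculus in the square root of the contrast\<close>

lemma bigo_one_of_diff:
  fixes g \<rho> :: "'a \<Rightarrow> complex"
  assumes "(\<lambda>z. g z - c) \<in> O[F](\<rho>)" "(\<rho> \<longlongrightarrow> 0) F"
  shows "g \<in> O[F](\<lambda>_. 1)"
proof -
  have "\<rho> \<in> o[F](\<lambda>_. 1)" using assms(2) by (auto intro!: smalloI_tendsto)
  then have "(\<lambda>z. g z - c) \<in> O[F](\<lambda>_. 1)"
    using assms(1) by (blast intro: landau_o.big_trans landau_o.small_imp_big)
  then have "(\<lambda>z. (g z - c) + c) \<in> O[F](\<lambda>_. 1)"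
    by (rule sum_in_bigo) simp
  then show ?thesis by simp
qed

lemma bigo_power_mono:
  fixes \<rho> :: "'a \<Rightarrow> complex"
  assumes "(\<rho> \<longlongrightarrow> 0) F" "m \<le> n" "g \<in> O[F](\<lambda>z. \<rho> z ^ n)"
  shows "g \<in> O[F](\<lambda>z. \<rho> z ^ m)"
proof -
  have "\<forall>\<^sub>F z in F. norm (\<rho> z) < 1"
    using tendsto_norm_zero [OF assms(1)] by (rule order_tendstoD) simp
  then have "(\<lambda>z. \<rho> z ^ n) \<in> O[F](\<lambda>z. \<rho> z ^ m)"
    by (intro landau_o.bigI [of 1])
       (auto elim!: eventually_mono simp: norm_power intro!: power_decreasing \<open>m \<le> n\<close>)
  with assms(3) show ?thesis by (rule landau_o.big_trans)
qed

lemma bigo_of_first_order: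
  fixes \<rho> k :: "'a \<Rightarrow> complex"
  assumes \<rho>: "(\<rho> \<longlongrightarrow> 0) F" and k: "(\<lambda>z. k z - \<beta> * \<rho> z) \<in> O[F](\<lambda>z. \<rho> z ^ 2)"
  shows "k \<in> O[F](\<rho>)"
proof -
  have "(\<lambda>z. k z - \<beta> * \<rho> z) \<in> O[F](\<rho>)"
    using bigo_power_mono [OF \<rho> _ k, of 1] by simp
  moreover have "(\<lambda>z. \<beta> * \<rho> z) \<in> O[F](\<rho>)" by simp
  ultimately have "(\<lambda>z. k z - \<beta> * \<rho> z + \<beta> * \<rho> z) \<in> O[F](\<rho>)"
    by (rule sum_in_bigo)
  then show ?thesis unfolding diff_add_cancel .
qed

lemma contrast_times_bigo:
  fixes \<rho> \<delta> g :: "'a \<Rightarrow> complex"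
  assumes "\<forall>\<^sub>F z in F. \<delta> z * \<rho> z ^ 2 = C" "g \<in> O[F](\<lambda>z. \<rho> z ^ (n + 2))"
  shows "(\<lambda>z. \<delta> z * g z) \<in> O[F](\<lambda>z. \<rho> z ^ n)"
proof -
  have "(\<lambda>z. \<delta> z * g z) \<in> O[F](\<lambda>z. \<delta> z * \<rho> z ^ (n + 2))"
    using assms(2) by (intro landau_o.big.mult) auto
  also have "(\<lambda>z. \<delta> z * \<rho> z ^ (n + 2)) \<in> O[F](\<lambda>z. \<rho> z ^ n)"
  proof -
    have "\<forall>\<^sub>F z in F. \<delta> z * \<rho> z ^ (n + 2) = C * \<rho> z ^ n"
      using assms(1) by eventually_elim (auto simp: power_add power2_eq_square)
    moreover have "(\<lambda>z. C * \<rho> z ^ n) \<in> O[F](\<lambda>z. \<rho> z ^ n)" by simp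
    ultimately show ?thesis by (subst landau_o.big.in_cong)
  qed
  finally show ?thesis .
qed

lemma uniform_bigo_at_point:
  fixes \<rho> :: "complex \<Rightarrow> complex"
  assumes "uniform_bigo F X g (\<lambda>z. norm (\<rho> z))" "x \<in> X"
  shows "(\<lambda>z. g z x) \<in> O[F](\<rho>)"
proof -
  obtain K where "\<forall>\<^sub>F z in F. \<forall>x\<in>X. norm (g z x) \<le> K * norm (\<rho> z)"
    using assms(1) by (auto simp: uniform_bigo_def)
  then show ?thesis
    using assms(2) by (intro bigoI [of _ K]) (auto elim: eventually_mono)
qed

lemma uniform_bigo_affine:
  fixes \<rho> p :: "complex \<Rightarrow> complex" and w :: "complex \<Rightarrow> real \<Rightarrow> complex"
  assumes dev: "uniform_bigo F {a..b} (\<lambda>z x. w z x - w z a - of_real (x - a) * p z) (\<lambda>z. norm (\<rho> z) ^ 2)"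
    and \<rho>: "(\<rho> \<longlongrightarrow> 0) F"
    and start: "(\<lambda>z. w z a - c) \<in> O[F](\<rho>)" and slope: "(\<lambda>z. p z - \<alpha>) \<in> O[F](\<rho>)"
  shows "uniform_bigo F {a..b} (\<lambda>z x. w z x - (c + \<alpha> * of_real (x - a))) (\<lambda>z. norm (\<rho> z))"
proof -
  obtain K1 where K1: "\<forall>\<^sub>F z in F. \<forall>x\<in>{a..b}.
      norm (w z x - w z a - of_real (x - a) * p z) \<le> K1 * norm (\<rho> z) ^ 2"
    using dev by (auto simp: uniform_bigo_def)
  obtain K2 where K2: "\<forall>\<^sub>F z in F. norm (w z a - c) \<le> K2 * norm (\<rho> z)"
    using start by (elim landau_o.bigE)
  obtain K3 where K3: "\<forall>\<^sub>F z in F. norm (p z - \<alpha>) \<le> K3 * norm (\<rho> z)"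
    using slope by (elim landau_o.bigE)
  have small: "\<forall>\<^sub>F z in F. norm (\<rho> z) < 1"
    using tendsto_norm_zero [OF \<rho>] by (rule order_tendstoD) simp
  show ?thesis
    unfolding uniform_bigo_def
  proof (rule exI [of _ "\<bar>K1\<bar> + K2 + (b - a) * K3"], use K1 K2 K3 small in eventually_elim)
    case (elim z)
    show ?case
    proof
      fix x assume x: "x \<in> {a..b}"
      have "norm (w z x - (c + \<alpha> * of_real (x - a))) =
            norm ((w z x - w z a - of_real (x - a) * p z) + (w z a - c) + of_real (x - a) * (p z - \<alpha>))"
        by (simp add: algebra_simps)
      also have "\<dots> \<le> norm (w z x - w z a - of_real (x - a) * p z) + norm (w z a - c)
                       + norm (of_real (x - a) * (p z - \<alpha>))"
        by norm
      also have "norm (w z x - w z a - of_real (x - a) * p z) \<le> \<bar>K1\<bar> * norm (\<rho> z)"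
      proof -
        have "norm (w z x - w z a - of_real (x - a) * p z) \<le> K1 * norm (\<rho> z) ^ 2"
          using elim(1) x by blast
        also have "\<dots> \<le> \<bar>K1\<bar> * norm (\<rho> z)"
          using elim(4) by (intro mult_mono) (auto simp: power2_eq_square mult_left_le)
        finally show ?thesis .
      qed
      also note elim(2)
      also have "norm (of_real (x - a) * (p z - \<alpha>)) \<le> (b - a) * (K3 * norm (\<rho> z))"
        unfolding norm_mult using x elim(3) by (intro mult_mono) (auto simp flip: of_real_diff)
      finally show "norm (w z x - (c + \<alpha> * of_real (x - a))) \<le> (\<bar>K1\<bar> + K2 + (b - a) * K3) * norm (\<rho> z)"
        by (simp add: algebra_simps)
    qed
  qed
qed

section \<open>Propagation through resonators and gaps\<close>

text \<open>
  Inside a resonator the slope is bounded and changes only by \<open>O(\<rho>\<^sup>2)\<close>, so value and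
  slope are carried along the tangent.
\<close>

lemma resonator_step:
  fixes \<rho> \<kappa> p q :: "complex \<Rightarrow> complex" and w :: "complex \<Rightarrow> real \<Rightarrow> complex"
  assumes "a < b" and hb: "\<forall>\<^sub>F z in F. helmholtz_between (\<kappa> z) a b (w z) (p z) (q z)"
    and \<rho>: "(\<rho> \<longlongrightarrow> 0) F" and \<kappa>: "\<kappa> \<in> O[F](\<rho>)"
    and start: "(\<lambda>z. w z a - c) \<in> O[F](\<rho>)" and slope: "(\<lambda>z. p z - \<alpha>) \<in> O[F](\<rho>)"
  shows "uniform_bigo F {a..b} (\<lambda>z x. w z x - (c + \<alpha> * of_real (x - a))) (\<lambda>z. norm (\<rho> z))"
    and "(\<lambda>z. w z b - (c + \<alpha> * of_real (b - a))) \<in> O[F](\<rho>)"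
    and "(\<lambda>z. q z - \<alpha>) \<in> O[F](\<rho>)"
proof -
  note asym = helmholtz_between_asymptotics [OF \<open>a < b\<close> hb \<kappa> \<rho>
      bigo_one_of_diff [OF start \<rho>] bigo_one_of_diff [OF slope \<rho>]]
  show aff: "uniform_bigo F {a..b} (\<lambda>z x. w z x - (c + \<alpha> * of_real (x - a))) (\<lambda>z. norm (\<rho> z))"
    by (rule uniform_bigo_affine [OF asym(1) \<rho> start slope])
  show "(\<lambda>z. w z b - (c + \<alpha> * of_real (b - a))) \<in> O[F](\<rho>)"
    by (rule uniform_bigo_at_point [OF aff]) (use \<open>a < b\<close> in simp)
  have "(\<lambda>z. q z - p z) \<in> O[F](\<rho>)"
    using bigo_power_mono [OF \<rho> _ asym(2), of 1] by simp
  from sum_in_bigo(1) [OF this slope] show "(\<lambda>z. q z - \<alpha>) \<in> O[F](\<rho>)" by simp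
qed

text \<open>
  The natural unknown in a gap is the slope multiplied by the contrast. The change
  \<open>-\<kappa>\<^sup>2 (b - a) w\<close> of the slope is negligible for the values of \<open>w\<close>, but it has the same order \<open>\<rho>\<^sup>2\<close>
  as the slope, and after multiplication by \<open>\<delta>\<close> it contributes the finite term
  \<open>-C \<beta>\<^sup>2 (b - a) c\<close>. The error \<open>O(\<rho>\<^sup>3)\<close> of the slope becomes \<open>O(\<rho>)\<close>.
\<close>

lemma gap_step:
  fixes \<rho> \<delta> \<kappa> p q :: "complex \<Rightarrow> complex" and w :: "complex \<Rightarrow> real \<Rightarrow> complex" and C :: complex
  assumes "a < b" and hb: "\<forall>\<^sub>F z in F. helmholtz_between (\<kappa> z) a b (w z) (p z) (q z)"
    and \<rho>: "(\<rho> \<longlongrightarrow> 0) F" and \<kappa>: "(\<lambda>z. \<kappa> z - \<beta> * \<rho> z) \<in> O[F](\<lambda>z. \<rho> z ^ 2)"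
    and \<delta>: "\<forall>\<^sub>F z in F. \<delta> z * \<rho> z ^ 2 = C" and "C \<noteq> 0"
    and start: "(\<lambda>z. w z a - c) \<in> O[F](\<rho>)" and slope: "(\<lambda>z. \<delta> z * p z - \<alpha>) \<in> O[F](\<rho>)"
  shows "p \<in> O[F](\<lambda>z. \<rho> z ^ 2)"
    and "uniform_bigo F {a..b} (\<lambda>z x. w z x - c) (\<lambda>z. norm (\<rho> z))"
    and "(\<lambda>z. w z b - c) \<in> O[F](\<rho>)"
    and "(\<lambda>z. \<delta> z * q z - (\<alpha> - C * \<beta>\<^sup>2 * of_real (b - a) * c)) \<in> O[F](\<rho>)"
proof -
  have \<kappa>1: "\<kappa> \<in> O[F](\<rho>)" by (rule bigo_of_first_order [OF \<rho> \<kappa>])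
  have w1: "(\<lambda>z. w z a) \<in> O[F](\<lambda>_. 1)"
    by (rule bigo_one_of_diff [OF start \<rho>])
  have "(\<lambda>z. (\<delta> z * p z) * \<rho> z ^ 2) \<in> O[F](\<lambda>z. 1 * \<rho> z ^ 2)"
    using bigo_one_of_diff [OF slope \<rho>] by (intro landau_o.big.mult) auto
  then have "(\<lambda>z. (\<delta> z * p z) * \<rho> z ^ 2) \<in> O[F](\<lambda>z. \<rho> z ^ 2)" unfolding mult_1_left .
  moreover have "\<forall>\<^sub>F z in F. (\<delta> z * p z) * \<rho> z ^ 2 = C * p z"
    using \<delta> by (auto elim!: eventually_mono simp: algebra_simps)
  ultimately have "(\<lambda>z. C * p z) \<in> O[F](\<lambda>z. \<rho> z ^ 2)"
    by (subst (asm) landau_o.big.in_cong)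
  then show p: "p \<in> O[F](\<lambda>z. \<rho> z ^ 2)" using \<open>C \<noteq> 0\<close> by simp
  have p1: "p \<in> O[F](\<rho>)" using bigo_power_mono [OF \<rho> _ p, of 1] by simp
  note asym = helmholtz_between_asymptotics [OF \<open>a < b\<close> hb \<kappa>1 \<rho> w1]
  have p0: "p \<in> O[F](\<lambda>_. 1)" using bigo_power_mono [OF \<rho> _ p, of 0] by simp
  show unif: "uniform_bigo F {a..b} (\<lambda>z x. w z x - c) (\<lambda>z. norm (\<rho> z))"
    using uniform_bigo_affine [OF asym(1) [OF p0] \<rho> start, of 0] p1 by simp
  show "(\<lambda>z. w z b - c) \<in> O[F](\<rho>)"
    by (rule uniform_bigo_at_point [OF unif]) (use \<open>a < b\<close> in simp)
  \<comment> \<open>the part of the slope change that is not due to the leading value of \<open>w\<close>\<close>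
  define E where "E = (\<lambda>z. q z - p z + (\<kappa> z)\<^sup>2 * of_real (b - a) * w z a)"
  have "E \<in> O[F](\<lambda>z. \<rho> z ^ (1 + 2))"
    unfolding E_def by (rule bigo_power_mono [OF \<rho> _ asym(3) [OF p0 p]]) simp
  from contrast_times_bigo [OF \<delta> this] have E: "(\<lambda>z. \<delta> z * E z) \<in> O[F](\<rho>)" by simp
  have "(\<lambda>z. \<kappa> z + \<beta> * \<rho> z) \<in> O[F](\<rho>)"
    by (rule sum_in_bigo(1) [OF \<kappa>1]) simp
  from landau_o.big.mult [OF \<kappa> this]
  have "(\<lambda>z. (\<kappa> z - \<beta> * \<rho> z) * (\<kappa> z + \<beta> * \<rho> z)) \<in> O[F](\<lambda>z. \<rho> z ^ 2 * \<rho> z)" .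
  also have "(\<lambda>z. (\<kappa> z - \<beta> * \<rho> z) * (\<kappa> z + \<beta> * \<rho> z)) = (\<lambda>z. (\<kappa> z)\<^sup>2 - \<beta>\<^sup>2 * (\<rho> z)\<^sup>2)"
    by (simp add: algebra_simps power2_eq_square)
  also have "(\<lambda>z. \<rho> z ^ 2 * \<rho> z) = (\<lambda>z. \<rho> z ^ (1 + 2))"
    by (simp add: power2_eq_square mult_ac)
  finally have "(\<lambda>z. (\<kappa> z)\<^sup>2 - \<beta>\<^sup>2 * (\<rho> z)\<^sup>2) \<in> O[F](\<lambda>z. \<rho> z ^ (1 + 2))" .
  from landau_o.big.mult [OF contrast_times_bigo [OF \<delta> this] w1]
  have D: "(\<lambda>z. \<delta> z * ((\<kappa> z)\<^sup>2 - \<beta>\<^sup>2 * (\<rho> z)\<^sup>2) * w z a) \<in> O[F](\<rho>)" by simp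
  have D': "(\<lambda>z. of_real (b - a) * (\<delta> z * ((\<kappa> z)\<^sup>2 - \<beta>\<^sup>2 * (\<rho> z)\<^sup>2) * w z a)) \<in> O[F](\<rho>)"
    using D by simp
  have start': "(\<lambda>z. C * \<beta>\<^sup>2 * of_real (b - a) * (w z a - c)) \<in> O[F](\<rho>)"
    using start by simp
  have "(\<lambda>z. (\<delta> z * p z - \<alpha>) + \<delta> z * E z
           - of_real (b - a) * (\<delta> z * ((\<kappa> z)\<^sup>2 - \<beta>\<^sup>2 * (\<rho> z)\<^sup>2) * w z a)
           - C * \<beta>\<^sup>2 * of_real (b - a) * (w z a - c)) \<in> O[F](\<rho>)"
    by (rule sum_in_bigo(2) [OF sum_in_bigo(2) [OF sum_in_bigo(1) [OF slope E] D'] start'])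
  moreover have "\<forall>\<^sub>F z in F. (\<delta> z * p z - \<alpha>) + \<delta> z * E z
           - of_real (b - a) * (\<delta> z * ((\<kappa> z)\<^sup>2 - \<beta>\<^sup>2 * (\<rho> z)\<^sup>2) * w z a)
           - C * \<beta>\<^sup>2 * of_real (b - a) * (w z a - c)
         = \<delta> z * q z - (\<alpha> - C * \<beta>\<^sup>2 * of_real (b - a) * c)"
    using \<delta>
  proof eventually_elim
    case (elim z)
    show ?case unfolding elim [symmetric] E_def by (simp add: algebra_simps)
  qed
  ultimately show "(\<lambda>z. \<delta> z * q z - (\<alpha> - C * \<beta>\<^sup>2 * of_real (b - a) * c)) \<in> O[F](\<rho>)"
    by (subst (asm) landau_o.big.in_cong)
qed

text \<open>
  Alternating the two steps propagates the expansion of the pair (value, inner slope) from one left end point \<open>xm j\<close>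
  to the next.
\<close>

lemma mode_expansion:
  fixes \<rho> \<delta> k kb :: "complex \<Rightarrow> complex" and w :: "complex \<Rightarrow> real \<Rightarrow> complex"
    and dm dp :: "complex \<Rightarrow> nat \<Rightarrow> complex" and a c :: "nat \<Rightarrow> complex" and C :: complex
  assumes chain: "resonator_chain N xm xp M"
    and \<rho>: "(\<rho> \<longlongrightarrow> 0) F" and \<delta>: "\<forall>\<^sub>F z in F. \<delta> z * \<rho> z ^ 2 = C" and "C \<noteq> 0"
    and k: "(\<lambda>z. k z - \<beta> * \<rho> z) \<in> O[F](\<lambda>z. \<rho> z ^ 2)" and kb: "kb \<in> O[F](\<rho>)"
    and res: "\<And>j. j \<in> {1..N} \<Longrightarrow> \<forall>\<^sub>F z in F.
        helmholtz_between (kb z) (xm j) (xp j) (w z) (\<delta> z * dm z j) (\<delta> z * dp z j)"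
    and gap: "\<And>j. j \<in> {1..N} \<Longrightarrow> \<forall>\<^sub>F z in F.
        helmholtz_between (k z) (xp j) (xm (j + 1)) (w z) (dp z j) (dm z (j + 1))"
    and w1: "(\<lambda>z. w z (xm 1) - c 1) \<in> O[F](\<rho>)" and a1: "(\<lambda>z. \<delta> z * dm z 1 - a 1) \<in> O[F](\<rho>)"
    and c: "\<And>j. j \<ge> 1 \<Longrightarrow> c (j + 1) = c j + a j * of_real (res_len xm xp j)"
    and a: "\<And>j. j \<ge> 1 \<Longrightarrow> a (j + 1) = a j - C * \<beta>\<^sup>2 * of_real (res_gap xm xp j) * c (j + 1)"
    and j: "j \<in> {1..N}"
  shows "uniform_bigo F {xm j..xp j} (\<lambda>z x. w z x - (c j + a j * of_real (x - xm j))) (\<lambda>z. norm (\<rho> z))"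
    and "uniform_bigo F {xp j..xm (j + 1)} (\<lambda>z x. w z x - c (j + 1)) (\<lambda>z. norm (\<rho> z))"
    and "(\<lambda>z. dp z j) \<in> O[F](\<lambda>z. \<rho> z ^ 2)"
proof -
  have lt: "xm j < xp j" "xp j < xm (j + 1)" if "j \<in> {1..N}" for j
    using chain that by (auto simp: resonator_chain_def)
  have through_res: "(\<lambda>z. w z (xp j) - c (j + 1)) \<in> O[F](\<rho>)" "(\<lambda>z. \<delta> z * dp z j - a j) \<in> O[F](\<rho>)"
    if "j \<in> {1..N}" "(\<lambda>z. w z (xm j) - c j) \<in> O[F](\<rho>)" "(\<lambda>z. \<delta> z * dm z j - a j) \<in> O[F](\<rho>)" for j
    using resonator_step(2,3) [OF lt(1) res \<rho> kb, of j] c [of j] that by (auto simp: res_len_def)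
  have entry: "(\<lambda>z. w z (xm j) - c j) \<in> O[F](\<rho>) \<and> (\<lambda>z. \<delta> z * dm z j - a j) \<in> O[F](\<rho>)"
    if "1 \<le> j" "j \<le> N" for j
    using that
  proof (induction j rule: nat_induct_at_least)
    case base
    show ?case using w1 a1 by simp
  next
    case (Suc n)
    then have n: "n \<in> {1..N}" by simp
    note exit = through_res [OF n] Suc
    from gap_step(3,4) [OF lt(2) [OF n] gap [OF n] \<rho> k \<delta> \<open>C \<noteq> 0\<close>] exit a [of n]
    show ?case by (auto simp: res_gap_def)
  qed
  have "1 \<le> j" "j \<le> N" using j by auto
  note entry = entry [OF this]
  note exit = through_res [OF j conjunct1 [OF entry] conjunct2 [OF entry]]
  show "uniform_bigo F {xm j..xp j} (\<lambda>z x. w z x - (c j + a j * of_real (x - xm j))) (\<lambda>z. norm (\<rho> z))"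
    by (rule resonator_step(1) [OF lt(1) res \<rho> kb]) (use entry j in auto)
  show "uniform_bigo F {xp j..xm (j + 1)} (\<lambda>z x. w z x - c (j + 1)) (\<lambda>z. norm (\<rho> z))"
    and "(\<lambda>z. dp z j) \<in> O[F](\<lambda>z. \<rho> z ^ 2)"
    by (rule gap_step(2,1) [OF lt(2) gap \<rho> k \<delta> \<open>C \<noteq> 0\<close> exit]; use j in simp)+
qed

section \<open>The two ends of the chain\<close>

text \<open>
  In the outgoing wave \<open>\<rho> exp (-i k x)\<close> both the amplitude and the wave number are \<open>O(\<rho>)\<close>, so its slope is
  \<open>O(\<rho>\<^sup>2)\<close>. The contrast turns it into a bounded slope at the entrance of the first resonator, while the
  value there tends to zero.
\<close>

lemma incoming_data:
  fixes \<rho> \<delta> k :: "complex \<Rightarrow> complex" and C \<beta> :: complex and x :: real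
  assumes \<rho>: "(\<rho> \<longlongrightarrow> 0) F" and \<delta>: "\<forall>\<^sub>F z in F. \<delta> z * \<rho> z ^ 2 = C"
    and k: "(\<lambda>z. k z - \<beta> * \<rho> z) \<in> O[F](\<lambda>z. \<rho> z ^ 2)"
  shows "(\<lambda>z. \<rho> z * exp (- \<i> * k z * of_real x)) \<in> O[F](\<rho>)"
    and "(\<lambda>z. \<delta> z * (- \<i> * k z * (\<rho> z * exp (- \<i> * k z * of_real x))) - (- \<i> * C * \<beta>)) \<in> O[F](\<rho>)"
proof -
  define E where "E = (\<lambda>z. exp (- \<i> * k z * of_real x))"
  have k1: "k \<in> O[F](\<rho>)" by (rule bigo_of_first_order [OF \<rho> k])
  have y: "(\<lambda>z. - \<i> * k z * of_real x) \<in> O[F](\<rho>)"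
    using landau_o.big.mult [OF bigo_const [of "- \<i> * of_real x"] k1] by (simp add: mult_ac)
  have lim: "((\<lambda>z. - \<i> * k z * of_real x) \<longlongrightarrow> 0) F" by (rule bigo_tendsto_zero [OF y \<rho>])
  have "(\<lambda>t::complex. exp t - 1 - t) \<in> O[nhds 0](\<lambda>t. t\<^sup>2)"
    using analytic_first_order [OF holomorphic_on_imp_analytic_at [OF holomorphic_on_exp open_UNIV UNIV_I]]
    by (simp add: DERIV_imp_deriv [OF DERIV_exp])
  from landau_o.big.compose [OF this lim]
  have "(\<lambda>z. E z - 1 - (- \<i> * k z * of_real x)) \<in> O[F](\<lambda>z. (- \<i> * k z * of_real x)\<^sup>2)"
    by (simp add: E_def)
  also have "(\<lambda>z. (- \<i> * k z * of_real x)\<^sup>2) \<in> O[F](\<lambda>z. (\<rho> z)\<^sup>2)"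
    by (rule landau_o.big_power [OF y])
  finally have "(\<lambda>z. E z - 1 - (- \<i> * k z * of_real x)) \<in> O[F](\<rho>)"
    using bigo_power_mono [OF \<rho>, of 1 2] by simp
  from sum_in_bigo(1) [OF this y] have E1: "(\<lambda>z. E z - 1) \<in> O[F](\<rho>)" by simp
  have E: "E \<in> O[F](\<lambda>_. 1)" by (rule bigo_one_of_diff [OF E1 \<rho>])
  from landau_o.big.mult [OF landau_o.big_refl E]
  show "(\<lambda>z. \<rho> z * exp (- \<i> * k z * of_real x)) \<in> O[F](\<rho>)" by (simp add: E_def)
  have cube: "(\<lambda>z. \<rho> z ^ 2 * \<rho> z * 1) = (\<lambda>z. \<rho> z ^ (1 + 2))" "(\<lambda>z. 1 * \<rho> z ^ 2 * \<rho> z) = (\<lambda>z. \<rho> z ^ (1 + 2))"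
    by (simp_all add: power2_eq_square mult_ac)
  have "(\<lambda>z. (k z - \<beta> * \<rho> z) * \<rho> z * E z) \<in> O[F](\<lambda>z. \<rho> z ^ 2 * \<rho> z * 1)"
    by (rule landau_o.big.mult [OF landau_o.big.mult [OF k landau_o.big_refl] E])
  moreover have "(\<lambda>z. \<beta> * \<rho> z ^ 2 * (E z - 1)) \<in> O[F](\<lambda>z. 1 * \<rho> z ^ 2 * \<rho> z)"
    by (rule landau_o.big.mult [OF landau_o.big.mult [OF bigo_const landau_o.big_refl] E1])
  ultimately have "(\<lambda>z. (k z - \<beta> * \<rho> z) * \<rho> z * E z + \<beta> * \<rho> z ^ 2 * (E z - 1)) \<in> O[F](\<lambda>z. \<rho> z ^ (1 + 2))"
    unfolding cube by (rule sum_in_bigo)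
  from landau_o.big.mult [OF bigo_const [of "- \<i>"] contrast_times_bigo [OF \<delta> this]]
  have "(\<lambda>z. - \<i> * (\<delta> z * ((k z - \<beta> * \<rho> z) * \<rho> z * E z + \<beta> * \<rho> z ^ 2 * (E z - 1)))) \<in> O[F](\<rho>)" by simp
  moreover have "\<forall>\<^sub>F z in F. - \<i> * (\<delta> z * ((k z - \<beta> * \<rho> z) * \<rho> z * E z + \<beta> * \<rho> z ^ 2 * (E z - 1)))
      = \<delta> z * (- \<i> * k z * (\<rho> z * E z)) - (- \<i> * C * \<beta>)"
    using \<delta>
  proof eventually_elim
    case (elim z)
    show ?case unfolding elim [symmetric] by (simp add: algebra_simps power2_eq_square)
  qed
  ultimately show "(\<lambda>z. \<delta> z * (- \<i> * k z * (\<rho> z * exp (- \<i> * k z * of_real x))) - (- \<i> * C * \<beta>)) \<in> O[F](\<rho>)"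
    unfolding E_def by (subst (asm) landau_o.big.in_cong)
qed

text \<open>
  From \<open>D = i k V\<close> with \<open>k\<close> of exact order \<open>\<rho>\<close> and \<open>D = O(\<rho>\<^sup>2)\<close> it follows that \<open>V = O(\<rho>)\<close>, so the limit
  of \<open>V\<close> is zero.
\<close>

lemma outgoing_limit_zero:
  fixes \<rho> k V D :: "complex \<Rightarrow> complex"
  assumes "F \<noteq> bot" and \<rho>: "(\<rho> \<longlongrightarrow> 0) F" "\<forall>\<^sub>F z in F. \<rho> z \<noteq> 0"
    and k: "(\<lambda>z. k z - \<beta> * \<rho> z) \<in> O[F](\<lambda>z. \<rho> z ^ 2)" and "\<beta> \<noteq> 0"
    and V: "(\<lambda>z. V z - c) \<in> O[F](\<rho>)" and D: "D \<in> O[F](\<lambda>z. \<rho> z ^ 2)"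
    and rad: "\<forall>\<^sub>F z in F. D z = \<i> * k z * V z"
  shows "c = 0"
proof -
  have "(\<lambda>z. - \<i> * D z) \<in> O[F](\<lambda>z. \<rho> z ^ 2)" using D by simp
  moreover have "(\<lambda>z. (k z - \<beta> * \<rho> z) * V z) \<in> O[F](\<lambda>z. \<rho> z ^ 2 * 1)"
    using k bigo_one_of_diff [OF V \<rho>(1)] by (rule landau_o.big.mult)
  moreover have "(\<lambda>z. \<beta> * \<rho> z * (V z - c)) \<in> O[F](\<lambda>z. 1 * \<rho> z * \<rho> z)"
    by (rule landau_o.big.mult [OF landau_o.big.mult [OF bigo_const landau_o.big_refl] V])
  ultimately have "(\<lambda>z. - \<i> * D z - (k z - \<beta> * \<rho> z) * V z - \<beta> * \<rho> z * (V z - c)) \<in> O[F](\<lambda>z. \<rho> z ^ 2)"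
    unfolding mult_1_left mult_1_right power2_eq_square [symmetric] by (intro sum_in_bigo(2))
  moreover have "\<forall>\<^sub>F z in F. - \<i> * D z - (k z - \<beta> * \<rho> z) * V z - \<beta> * \<rho> z * (V z - c) = \<rho> z * (\<beta> * c)"
    using rad by eventually_elim (simp add: algebra_simps)
  ultimately have "(\<lambda>z. \<rho> z * (\<beta> * c)) \<in> O[F](\<lambda>z. \<rho> z ^ 2)"
    by (subst (asm) landau_o.big.in_cong)
  then obtain K where "\<forall>\<^sub>F z in F. norm (\<rho> z * (\<beta> * c)) \<le> K * norm (\<rho> z ^ 2)"
    by (elim landau_o.bigE)
  with \<rho>(2) have "\<forall>\<^sub>F z in F. norm (\<beta> * c) \<le> K * norm (\<rho> z)"
  proof eventually_elim
    case (elim z)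
    then have "norm (\<rho> z) * norm (\<beta> * c) \<le> norm (\<rho> z) * (K * norm (\<rho> z))"
      by (simp add: norm_mult power2_eq_square mult_ac)
    with elim show ?case by simp
  qed
  then have "(\<lambda>_. \<beta> * c) \<in> O[F](\<rho>)" by (rule bigoI)
  from bigo_tendsto_zero [OF this \<rho>(1)] have "((\<lambda>_. \<beta> * c) \<longlongrightarrow> 0) F" .
  then show "c = 0" using \<open>F \<noteq> bot\<close> \<open>\<beta> \<noteq> 0\<close> by (simp add: tendsto_const_iff)
qed

section \<open>The expansion of the mode\<close>

lemma sqrt_branch_filter:
  assumes "sqrt_branch S \<rho>"
  shows "at 0 within S \<noteq> bot"
    and "\<forall>\<^sub>F z in at 0 within S. z \<noteq> 0 \<and> (\<rho> z)\<^sup>2 = z"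
    and "(\<rho> \<longlongrightarrow> 0) (at 0 within S)"
proof -
  show "at 0 within S \<noteq> bot"
    using assms by (simp add: sqrt_branch_def trivial_limit_within)
  show ev: "\<forall>\<^sub>F z in at 0 within S. z \<noteq> 0 \<and> (\<rho> z)\<^sup>2 = z"
    using assms by (auto simp: sqrt_branch_def eventually_at_filter)
  have "((\<lambda>z::complex. z) \<longlongrightarrow> 0) (at 0 within S)" by (rule tendsto_ident_at)
  then have "((\<lambda>z. (\<rho> z)\<^sup>2) \<longlongrightarrow> 0) (at 0 within S)"
    by (rule Lim_transform_eventually) (use ev in \<open>auto elim: eventually_mono\<close>)
  from tendsto_norm_zero [OF this] have "((\<lambda>z. norm (\<rho> z) ^ 2) \<longlongrightarrow> 0) (at 0 within S)"
    by (simp only: norm_power)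
  then have "((\<lambda>z. norm (\<rho> z)) \<longlongrightarrow> 0) (at 0 within S)"
    by (subst (asm) power_tendsto_0_iff) simp_all
  then show "(\<rho> \<longlongrightarrow> 0) (at 0 within S)" by (rule tendsto_norm_zero_cancel)
qed

lemma analytic_in_sqrt_expansion:
  assumes branch: "sqrt_branch S \<rho>" and "analytic_in_sqrt S \<rho> \<omega>"
    and lim: "(\<omega> \<longlongrightarrow> 0) (at 0 within S)"
  obtains f1 where "(\<lambda>z. \<omega> z - f1 * \<rho> z) \<in> O[at 0 within S](\<lambda>z. \<rho> z ^ 2)"
proof -
  note F = sqrt_branch_filter [OF branch]
  obtain f where f: "f analytic_on {0}" and eq: "\<forall>\<^sub>F z in at 0 within S. \<omega> z = f (\<rho> z)"
    using assms by (auto simp: analytic_in_sqrt_def)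
  have "isCont f 0" using f by (simp add: analytic_at_imp_isCont)
  then have "((\<lambda>z. f (\<rho> z)) \<longlongrightarrow> f 0) (at 0 within S)"
    by (rule isCont_tendsto_compose) (rule F(3))
  moreover have "((\<lambda>z. f (\<rho> z)) \<longlongrightarrow> 0) (at 0 within S)"
    using lim eq by (rule Lim_transform_eventually)
  ultimately have "f 0 = 0" using F(1) tendsto_unique by blast
  from landau_o.big.compose [OF analytic_first_order [OF f] F(3)]
  have "(\<lambda>z. f (\<rho> z) - deriv f 0 * \<rho> z) \<in> O[at 0 within S](\<lambda>z. \<rho> z ^ 2)"
    by (simp add: \<open>f 0 = 0\<close>)
  moreover have "\<forall>\<^sub>F z in at 0 within S. \<omega> z - deriv f 0 * \<rho> z = f (\<rho> z) - deriv f 0 * \<rho> z"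
    using eq by eventually_elim simp
  ultimately have "(\<lambda>z. \<omega> z - deriv f 0 * \<rho> z) \<in> O[at 0 within S](\<lambda>z. \<rho> z ^ 2)"
    by (subst landau_o.big.in_cong)
  then show ?thesis by (rule that)
qed

text \<open>
  In absolute value, \<open>\<rho>\<close> and \<open>\<delta>\<^sup>-\<^sup>1\<^sup>/\<^sup>2\<close> differ by the constant factor \<open>r\<close>.
\<close>

lemma uniform_bigo_contrast:
  assumes branch: "sqrt_branch S \<rho>" and "r > 0" and \<delta>: "\<And>z. \<delta> z = (of_real r)\<^sup>2 / z"
    and unif: "uniform_bigo (at 0 within S) Y g (\<lambda>z. norm (\<rho> z))" and "X \<subseteq> Y"
  shows "uniform_bigo (at 0 within S) X g (\<lambda>z. norm (\<delta> z) powr (- 1 / 2))"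
proof -
  obtain K where K: "\<forall>\<^sub>F z in at 0 within S. \<forall>x\<in>Y. norm (g z x) \<le> K * norm (\<rho> z)"
    using unif by (auto simp: uniform_bigo_def)
  show ?thesis
    unfolding uniform_bigo_def
  proof (rule exI [of _ "K * r"], use K sqrt_branch_filter(2) [OF branch] in eventually_elim)
    case (elim z)
    have "\<rho> z \<noteq> 0" using elim(2) by auto
    have "norm (\<delta> z) = (r / norm (\<rho> z)) powr 2"
    proof -
      have "\<delta> z = (of_real r / \<rho> z)\<^sup>2" using elim(2) by (simp add: \<delta> power_divide)
      then have "norm (\<delta> z) = (r / norm (\<rho> z))\<^sup>2" using \<open>r > 0\<close> by (simp add: norm_power norm_divide)
      then show ?thesis using \<open>r > 0\<close> \<open>\<rho> z \<noteq> 0\<close> by (simp add: powr_numeral)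
    qed
    then have "norm (\<delta> z) powr (- 1 / 2) = norm (\<rho> z) / r"
      using \<open>r > 0\<close> \<open>\<rho> z \<noteq> 0\<close> by (simp add: powr_powr powr_minus_divide)
    then show ?case using elim(1) \<open>r > 0\<close> \<open>X \<subseteq> Y\<close> by auto
  qed
qed

theorem corollary4p7:
  fixes N :: nat and xm xp :: "nat \<Rightarrow> real" and M v vb r :: real
    and S :: "complex set" and \<rho> \<omega> \<delta> :: "complex \<Rightarrow> complex"
    and u w :: "complex \<Rightarrow> real \<Rightarrow> complex"
  assumes "resonator_chain N xm xp M"
    and "v > 0" and "vb > 0" and "r = v / vb"
    and "sqrt_branch S \<rho>"
    and "subwavelength_resonance N xm xp v vb S \<omega>"
    and "\<omega> \<in> O[at 0 within S](\<rho>)"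
    and "analytic_in_sqrt S \<rho> \<omega>"
    and "\<forall>\<^sub>F \<delta>0 in at 0 within S.
           eigenmode N xm xp v vb \<delta>0 (\<omega> \<delta>0) (u \<delta>0) \<and>
           (\<forall>x < xm 1. u \<delta>0 x = exp (- \<i> * (\<omega> \<delta>0 / of_real v) * of_real x))"
    and "\<And>\<delta>0. \<delta> \<delta>0 = (of_real r)\<^sup>2 / \<delta>0"
    and "\<forall>\<^sub>F \<delta>0 in at 0 within S.
           eigenmode N xm xp v vb (\<delta> \<delta>0) (\<omega> \<delta>0) (w \<delta>0) \<and>
           (\<forall>x < xm 1. w \<delta>0 x = \<rho> \<delta>0 * u \<delta>0 x)"
  shows "\<exists>(lam::real) (a :: nat \<Rightarrow> complex) (c :: nat \<Rightarrow> complex).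
           eigenvalue (cap_matrix N xm xp r) lam \<and> lam \<ge> 0 \<and>
           corresponds_to v r S \<rho> \<omega> lam \<and>
           (if lam = 0 then \<forall>j\<in>{1..N}. a j = 0
            else eigenvector (map_mat complex_of_real (cap_matrix N xm xp r))
                   (Matrix.vec N (\<lambda>i. a (i + 1))) (complex_of_real lam)) \<and>
           c 1 = 0 \<and>
           (\<forall>j\<in>{2..N + 1}. c j = c (j - 1) + a (j - 1) * of_real (res_len xm xp (j - 1))) \<and>
           (\<forall>j\<in>{1..N + 1}.
              uniform_bigo (at 0 within S) {xp (j - 1)<..<xm j}
                (\<lambda>\<delta>0 x. w \<delta>0 x - c j)
                (\<lambda>\<delta>0. norm (\<delta> \<delta>0) powr (- 1 / 2))) \<and>
           (\<forall>j\<in>{1..N}.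
              uniform_bigo (at 0 within S) {xm j<..<xp j}
                (\<lambda>\<delta>0 x. w \<delta>0 x - (c j + a j * of_real (x - xm j)))
                (\<lambda>\<delta>0. norm (\<delta> \<delta>0) powr (- 1 / 2)))"

proof -
  let ?F = "at 0 within S"
  note chain = assms(1) and v = \<open>v > 0\<close> and vb = \<open>vb > 0\<close> and branch = assms(5)
  note \<delta>_def = assms(10)
  have r: "r > 0" using v vb \<open>r = v / vb\<close> by simp
  have N: "N \<ge> 1" using chain by (simp add: resonator_chain_def)
  note F = sqrt_branch_filter [OF branch]
  have \<rho>0: "\<forall>\<^sub>F z in ?F. \<rho> z \<noteq> 0" using F(2) by eventually_elim auto
  define C :: complex where "C = (of_real r)\<^sup>2"
  have C: "C \<noteq> 0" using r by (simp add: C_def)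
  have \<delta>: "\<forall>\<^sub>F z in ?F. \<delta> z * \<rho> z ^ 2 = C"
    using F(2) by eventually_elim (simp add: \<delta>_def C_def)
  have "(\<omega> \<longlongrightarrow> 0) ?F" using assms(6) by (simp add: subwavelength_resonance_def)
  then obtain f1 where f1: "(\<lambda>z. \<omega> z - f1 * \<rho> z) \<in> O[?F](\<lambda>z. \<rho> z ^ 2)"
    using analytic_in_sqrt_expansion [OF branch assms(8)] by blast
  define \<beta> where "\<beta> = f1 / of_real v"
  define k kb where "k = (\<lambda>z. \<omega> z / of_real v)" and "kb = (\<lambda>z. \<omega> z / of_real vb)"
  have "(\<lambda>z. 1 / of_real v * (\<omega> z - f1 * \<rho> z)) \<in> O[?F](\<lambda>z. 1 * \<rho> z ^ 2)"
    using f1 by (intro landau_o.big.mult) auto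
  then have k: "(\<lambda>z. k z - \<beta> * \<rho> z) \<in> O[?F](\<lambda>z. \<rho> z ^ 2)"
    by (simp add: k_def \<beta>_def diff_divide_distrib)
  have kb: "kb \<in> O[?F](\<rho>)" using \<open>\<omega> \<in> O[?F](\<rho>)\<close> vb by (simp add: kb_def)
  have kO: "k \<in> O[?F](\<rho>)" using \<open>\<omega> \<in> O[?F](\<rho>)\<close> v by (simp add: k_def)

  \<comment> \<open>a pair \<open>d = (dm, dp)\<close> of outer slopes for each contrast, so that they become functions of it\<close>
  have "\<forall>\<^sub>F z in ?F. \<exists>d. (\<forall>j\<in>{1..N}.
             helmholtz_between (kb z) (xm j) (xp j) (w z) (\<delta> z * fst d j) (\<delta> z * snd d j) \<and>
             helmholtz_between (k z) (xp j) (xm (j + 1)) (w z) (snd d j) (fst d (j + 1))) \<and>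
           fst d 1 = - \<i> * k z * w z (xm 1) \<and> snd d N = \<i> * k z * w z (xp N) \<and>
           (w z \<longlongrightarrow> w z (xm 1)) (at_left (xm 1))"
    using assms(11)
  proof eventually_elim
    case (elim z)
    then have "scattering_solution N xm xp v vb (\<delta> z) (\<omega> z) (w z)" by (simp add: eigenmode_def)
    from scattering_solution_profiles [OF chain this]
    obtain dm dp where "(\<forall>j\<in>{1..N}.
             helmholtz_between (kb z) (xm j) (xp j) (w z) (\<delta> z * dm j) (\<delta> z * dp j) \<and>
             helmholtz_between (k z) (xp j) (xm (j + 1)) (w z) (dp j) (dm (j + 1))) \<and>
           dm 1 = - \<i> * k z * w z (xm 1) \<and> dp N = \<i> * k z * w z (xp N) \<and>
           (w z \<longlongrightarrow> w z (xm 1)) (at_left (xm 1))"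
      unfolding k_def kb_def by blast
    then show ?case by (intro exI [of _ "(dm, dp)"]) simp
  qed
  then obtain d where d: "\<forall>\<^sub>F z in ?F. (\<forall>j\<in>{1..N}.
             helmholtz_between (kb z) (xm j) (xp j) (w z) (\<delta> z * fst (d z) j) (\<delta> z * snd (d z) j) \<and>
             helmholtz_between (k z) (xp j) (xm (j + 1)) (w z) (snd (d z) j) (fst (d z) (j + 1))) \<and>
           fst (d z) 1 = - \<i> * k z * w z (xm 1) \<and> snd (d z) N = \<i> * k z * w z (xp N) \<and>
           (w z \<longlongrightarrow> w z (xm 1)) (at_left (xm 1))"
    unfolding eventually_ex by blast
  define dm dp where "dm z = fst (d z)" and "dp z = snd (d z)" for z
  note d = d [folded dm_def dp_def]
  have res: "\<forall>\<^sub>F z in ?F. helmholtz_between (kb z) (xm j) (xp j) (w z) (\<delta> z * dm z j) (\<delta> z * dp z j)"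
    if "j \<in> {1..N}" for j
    by (rule eventually_mono [OF d]) (use that in blast)
  have gap: "\<forall>\<^sub>F z in ?F. helmholtz_between (k z) (xp j) (xm (j + 1)) (w z) (dp z j) (dm z (j + 1))"
    if "j \<in> {1..N}" for j
    by (rule eventually_mono [OF d]) (use that in blast)
  have w_left: "\<forall>\<^sub>F z in ?F. \<forall>x<xm 1. w z x = \<rho> z * exp (- \<i> * k z * of_real x)"
    using assms(9,11) by eventually_elim (simp add: k_def)
  have w1: "\<forall>\<^sub>F z in ?F. w z (xm 1) = \<rho> z * exp (- \<i> * k z * of_real (xm 1))"
    using d w_left
  proof eventually_elim
    case (elim z)
    have "((\<lambda>x. \<rho> z * exp (- \<i> * k z * of_real x)) \<longlongrightarrow> \<rho> z * exp (- \<i> * k z * of_real (xm 1))) (at_left (xm 1))"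
      by (intro tendsto_intros)
    moreover have "\<forall>\<^sub>F x in at_left (xm 1). \<rho> z * exp (- \<i> * k z * of_real x) = w z x"
      using elim(2) by (intro eventually_at_leftI [of "xm 1 - 1"]) auto
    ultimately have "(w z \<longlongrightarrow> \<rho> z * exp (- \<i> * k z * of_real (xm 1))) (at_left (xm 1))"
      by (rule Lim_transform_eventually)
    moreover have "(w z \<longlongrightarrow> w z (xm 1)) (at_left (xm 1))" using elim(1) by blast
    ultimately show ?case using tendsto_unique trivial_limit_at_left_real by blast
  qed

  \<comment> \<open>\<open>C \<beta>\<^sup>2 = r lam0\<close>, so \<open>lam0\<close> is the eigenvalue produced by the recurrence\<close>
  define lam0 :: complex where "lam0 = of_real r * \<beta>\<^sup>2"
  obtain a c where a1: "a 1 = - \<i> * C * \<beta>" and c1: "c 1 = 0" and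
    ca: "\<forall>j\<ge>1. c (j + 1) = c j + a j * of_real (res_len xm xp j) \<and>
                a (j + 1) = a j - C * \<beta>\<^sup>2 * of_real (res_gap xm xp j) * c (j + 1)"
    using limit_coefficients_exist [of "- \<i> * C * \<beta>" "res_len xm xp" "C * \<beta>\<^sup>2" "res_gap xm xp"] by blast
  note data = incoming_data [OF F(3) \<delta> k, of "xm 1"]
  have "\<forall>\<^sub>F z in ?F. w z (xm 1) - c 1 = \<rho> z * exp (- \<i> * k z * of_real (xm 1))"
    using w1 by (simp only: c1 diff_zero)
  then have start: "(\<lambda>z. w z (xm 1) - c 1) \<in> O[?F](\<rho>)"
    using data(1) by (subst landau_o.big.in_cong)
  have "\<forall>\<^sub>F z in ?F. \<delta> z * dm z 1 - a 1
      = \<delta> z * (- \<i> * k z * (\<rho> z * exp (- \<i> * k z * of_real (xm 1)))) - (- \<i> * C * \<beta>)"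
    using d w1
  proof eventually_elim
    case (elim z)
    then have "dm z 1 = - \<i> * k z * w z (xm 1)" by blast
    then show ?case unfolding a1 elim(2) [symmetric] by (simp only:)
  qed
  then have slope: "(\<lambda>z. \<delta> z * dm z 1 - a 1) \<in> O[?F](\<rho>)"
    using data(2) by (subst landau_o.big.in_cong)
  have c_rec: "c (j + 1) = c j + a j * of_real (res_len xm xp j)"
    and a_rec: "a (j + 1) = a j - C * \<beta>\<^sup>2 * of_real (res_gap xm xp j) * c (j + 1)" if "j \<ge> 1" for j
    using ca that by auto
  note expansion = mode_expansion [OF chain F(3) \<delta> C k kb res gap start slope c_rec a_rec]
  have inside: "uniform_bigo ?F {xm j..xp j} (\<lambda>z x. w z x - (c j + a j * of_real (x - xm j))) (\<lambda>z. norm (\<rho> z))"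
    if "j \<in> {1..N}" for j
    by (rule expansion(1) [OF _ _ _ _ that])
  have between: "uniform_bigo ?F {xp j..xm (j + 1)} (\<lambda>z x. w z x - c (j + 1)) (\<lambda>z. norm (\<rho> z))"
    if "j \<in> {1..N}" for j
    by (rule expansion(2) [OF _ _ _ _ that])
  have dp: "(\<lambda>z. dp z j) \<in> O[?F](\<lambda>z. \<rho> z ^ 2)" if "j \<in> {1..N}" for j
    by (rule expansion(3) [OF _ _ _ _ that])

  \<comment> \<open>to the left of the chain the mode is explicit, and \<open>k x\<close> is bounded as \<open>|x| \<le> M\<close>\<close>
  have left: "uniform_bigo ?F {xp 0<..<xm 1} (\<lambda>z x. w z x - c 1) (\<lambda>z. norm (\<rho> z))"
  proof -
    have "(k \<longlongrightarrow> 0) ?F" by (rule bigo_tendsto_zero [OF kO F(3)])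
    then have "((\<lambda>z. norm (k z) * M) \<longlongrightarrow> 0) ?F" by (auto intro!: tendsto_eq_intros)
    then have kM: "\<forall>\<^sub>F z in ?F. norm (k z) * M < 1" by (rule order_tendstoD) simp
    show ?thesis
      unfolding uniform_bigo_def
    proof (rule exI [of _ "exp 1"], use w_left kM in eventually_elim)
      case (elim z)
      show ?case
      proof
        fix x assume x: "x \<in> {xp 0<..<xm 1}"
        have M: "xp 0 = - M" "xm (N + 1) = M" using chain by (auto simp: resonator_chain_def)
        have "xm 1 \<le> M" using resonator_chain_mono(2) [OF chain, of 1 "N + 1"] M by simp
        with x M have "\<bar>x\<bar> \<le> M" by auto
        then have "norm (- \<i> * k z * of_real x) \<le> 1"
          using elim(2) mult_left_mono [of "\<bar>x\<bar>" M "norm (k z)"] by (simp add: norm_mult)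
        then have exp: "norm (exp (- \<i> * k z * of_real x)) \<le> exp 1"
          by (meson norm_exp exp_le_cancel_iff order_trans)
        have "w z x = \<rho> z * exp (- \<i> * k z * of_real x)" using elim(1) x by auto
        then have "norm (w z x - c 1) = norm (exp (- \<i> * k z * of_real x)) * norm (\<rho> z)"
          by (simp only: c1 diff_zero norm_mult mult.commute)
        with exp show "norm (w z x - c 1) \<le> exp 1 * norm (\<rho> z)"
          by (simp only: mult_right_mono norm_ge_zero)
      qed
    qed
  qed

  have spectral: "\<exists>lam::real. eigenvalue (cap_matrix N xm xp r) lam \<and> lam \<ge> 0 \<and> corresponds_to v r S \<rho> \<omega> lam \<and>
      (if lam = 0 then \<forall>j\<in>{1..N}. a j = 0
       else eigenvector (map_mat complex_of_real (cap_matrix N xm xp r))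
              (Matrix.vec N (\<lambda>i. a (i + 1))) (complex_of_real lam))"
  proof (cases "\<beta> = 0")
    case True
    then have "f1 = 0" using v by (simp add: \<beta>_def)
    have "a j = 0" if "j \<ge> 1" for j
      using that
    proof (induction j rule: nat_induct_at_least)
      case base
      then show ?case by (simp add: a1 [unfolded One_nat_def] True)
    next
      case (Suc n)
      then show ?case using a_rec [of n] by (simp add: True)
    qed
    moreover have "corresponds_to v r S \<rho> \<omega> 0"
    proof -
      have "\<forall>\<^sub>F z in ?F. \<rho> z ^ 2 = z" using F(2) by eventually_elim simp
      from landau_o.big.cong [OF this] have "\<omega> \<in> O[?F](\<lambda>z. z)" using f1 \<open>f1 = 0\<close> by simp
      then show ?thesis unfolding corresponds_to_def by (intro bexI [of _ 1]) simp_all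
    qed
    ultimately show ?thesis
      using cap_zero_eigenvalue [OF N, of xm xp r] by (intro exI [of _ 0]) auto
  next
    case False
    have "(\<lambda>z. w z (xp N) - c (N + 1)) \<in> O[?F](\<rho>)"
      by (rule uniform_bigo_at_point [OF between [of N]]) (use N chain in \<open>auto simp: resonator_chain_def less_imp_le\<close>)
    then have cN: "c (N + 1) = 0"
    proof (rule outgoing_limit_zero [OF F(1,3) \<rho>0 k False])
      show "(\<lambda>z. dp z N) \<in> O[?F](\<lambda>z. \<rho> z ^ 2)" using dp [of N] N by simp
      show "\<forall>\<^sub>F z in ?F. dp z N = \<i> * k z * w z (xp N)" using d by eventually_elim blast
    qed
    have "a 1 \<noteq> 0" unfolding a1 using False C by simp
    have "a (j + 1) = a j - of_real r * lam0 * of_real (res_gap xm xp j) * c (j + 1)" if "j \<ge> 1" for j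
      using a_rec [OF that] by (simp add: lam0_def C_def power2_eq_square)
    note ev = cap_eigenvector_of_limit [OF chain r c1 cN \<open>a 1 \<noteq> 0\<close> c_rec this]
    define lam where "lam = Re lam0"
    have lam: "lam0 = of_real lam" "lam > 0" using ev(1,2) by (auto simp: lam_def complex_eq_iff)
    have "of_real r * \<beta>\<^sup>2 = of_real lam" using lam(1) by (simp add: lam0_def)
    then have "\<beta>\<^sup>2 = of_real (lam / r)" using r by (simp add: field_simps)
    also have "lam / r = (sqrt (lam / r))\<^sup>2" using lam(2) r by simp
    finally have "\<beta>\<^sup>2 = (of_real (sqrt (lam / r)))\<^sup>2" by (simp only: of_real_power)
    then have "\<beta> = of_real (sqrt (lam / r)) \<or> \<beta> = - of_real (sqrt (lam / r))"
      by (simp add: power2_eq_iff)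
    then obtain \<sigma> :: complex where \<sigma>: "\<sigma> \<in> {1, -1}" "\<beta> = \<sigma> * of_real (sqrt (lam / r))"
    proof
      assume "\<beta> = of_real (sqrt (lam / r))"
      then show ?thesis by (intro that [of 1]) simp_all
    next
      assume "\<beta> = - of_real (sqrt (lam / r))"
      then show ?thesis by (intro that [of "-1"]) simp_all
    qed
    then have f1_eq: "f1 = \<sigma> * of_real v * of_real (sqrt (lam / r))"
      using v by (simp add: \<beta>_def field_simps)
    have "\<forall>\<^sub>F z in ?F. \<rho> z ^ 2 = z" using F(2) by eventually_elim simp
    from landau_o.big.cong [OF this] have "(\<lambda>z. \<omega> z - f1 * \<rho> z) \<in> O[?F](\<lambda>z. z)" using f1 by simp
    then have "corresponds_to v r S \<rho> \<omega> lam"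
      unfolding corresponds_to_def f1_eq by (rule bexI [OF _ \<sigma>(1)])
    moreover have "eigenvalue (cap_matrix N xm xp r) lam"
      by (rule cap_eigenvalue_of_complex) (use ev(3) lam in \<open>auto simp: eigenvalue_def\<close>)
    ultimately show ?thesis using ev(3) lam by (intro exI [of _ lam]) simp
  qed
  then obtain lam where lam: "eigenvalue (cap_matrix N xm xp r) lam" "lam \<ge> 0" "corresponds_to v r S \<rho> \<omega> lam"
      "if lam = 0 then \<forall>j\<in>{1..N}. a j = 0
       else eigenvector (map_mat complex_of_real (cap_matrix N xm xp r))
              (Matrix.vec N (\<lambda>i. a (i + 1))) (complex_of_real lam)"
    by blast
  note contrast = uniform_bigo_contrast [OF branch r \<delta>_def]
  show ?thesis
  proof (rule exI [of _ lam], rule exI [of _ a], rule exI [of _ c], intro conjI ballI)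
    fix j assume j: "j \<in> {2..N + 1}"
    then show "c j = c (j - 1) + a (j - 1) * of_real (res_len xm xp (j - 1))"
      using c_rec [of "j - 1"] by auto
  next
    fix j assume j: "j \<in> {1..N + 1}"
    show "uniform_bigo ?F {xp (j - 1)<..<xm j} (\<lambda>\<delta>0 x. w \<delta>0 x - c j) (\<lambda>\<delta>0. norm (\<delta> \<delta>0) powr (- 1 / 2))"
    proof (cases "j = 1")
      case True
      with contrast [OF left order_refl] show ?thesis by simp
    next
      case False
      with j have "j - 1 \<in> {1..N}" "j - 1 + 1 = j" by auto
      with between [of "j - 1"]
      have "uniform_bigo ?F {xp (j - 1)..xm j} (\<lambda>z x. w z x - c j) (\<lambda>z. norm (\<rho> z))" by metis
      then show ?thesis by (rule contrast) auto
    qed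
  next
    fix j assume "j \<in> {1..N}"
    show "uniform_bigo ?F {xm j<..<xp j} (\<lambda>\<delta>0 x. w \<delta>0 x - (c j + a j * of_real (x - xm j)))
        (\<lambda>\<delta>0. norm (\<delta> \<delta>0) powr (- 1 / 2))"
      by (rule contrast [OF inside [OF \<open>j \<in> {1..N}\<close>]]) auto
  qed (fact lam c1)+
qed

end
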